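(* Let $k\ge 4$, let $N$ be a positive multiple of $4$, and let $G^{\rm LP}$ be the LP relaxation permutation symmetry group of the orthogonal array defining integer linear program for $\mathrm{OA}(N,k,2,2)$ (the case $t=2$ of the program in the context). Then $$G^{\rm LP}\cong S_2^k\rtimes S_{k+1},$$ where the semidirect product is formed with respect to the action described in the context.
   Context: An $\mathrm{OA}(N,k,2,t)$ (with $1\le t\le k$ and $N$ a positive multiple of $2^t$) is an $N\times k$ array with entries from $\{1,-1\}$ such that in every choice of $t$ columns each $t$-tuple appears exactly $N/2^t$ times. Full factorial design: list the $2^k$ elements of $\{1,-1\}^k$ as the rows of a $2^k\times k$ matrix; for $i=1,\dots,k$ let $\mathbf{x}_i\in\{1,-1\}^{2^k}$ be its $i$-th column. Let $\mathbf{1}$ be the all-ones vector of length $2^k$. For distinct $i_1,\dots,i_j$ ($j\ge 2$), $\mathbf{x}_{i_1,\dots,i_j}=\mathbf{x}_{i_1}\odot\cdots\odot\mathbf{x}_{i_j}$ is the entrywise (Hadamard) product. For given $t$, let $\mathbf{M}$ be the $\sum_{i=0}^t\binom{k}{i}$ by $2^k$ matrix whose rows are $\mathbf{1}^\top$ and all $\mathbf{x}_{i_1,\dots,i_j}^\top$ with $1\le i_1<\cdots<i_j\le k$, $1\le j\le t$ (first row $\mathbf{1}^\top$), and let $\mathbf{J}=(N,0,\dots,0)^\top$. The $\mathrm{OA}(N,k,2,t)$ defining ILP is $$\min 0:\ \mathbf{M}\mathbf{f}=\mathbf{J},\ \mathbf{f}\ge\mathbf{0},\ \mathbf{f}\in\mathbb{Z}^{2^k}.$$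 Its LP relaxation has feasible set $\{\mathbf{f}\in\mathbb{Q}_{\ge 0}^{2^k}:\mathbf{M}\mathbf{f}=\mathbf{J}\}$. The symmetric group $S_{2^k}$ acts on vectors of length $2^k$ by permuting coordinates, and the LP relaxation permutation symmetry group $G^{\rm LP}$ is the group of all $\pi\in S_{2^k}$ that send every LP relaxation feasible point to an LP relaxation feasible point (the objective function is constant). The semidirect product $S_2^k\rtimes S_{k+1}$: identify $S_2^k$ with the multiplicative group $\{1,-1\}^k$ and regard $S_{k+1}$ as the symmetric group on $\{0,1,\dots,k\}$. The action of $S_{k+1}$ on $\{1,-1\}^k$ by group automorphisms is the one in which, for $i=1,\dots,k$, the transposition $(0\ i)$ acts by $\rho_i:(y_1,\dots,y_i,\dots,y_k)\mapsto(y_1y_i,\dots,y_{i-1}y_i,\,y_i,\,y_{i+1}y_i,\dots,y_ky_i)$ (equivalently, identify $\{1,-1\}^k$ with $\{1,-1\}^{k+1}/\{\pm(1,\dots,1)\}$, coordinates indexed by $0,\dots,k$, via $(y_1,\dots,y_k)\mapsto[(1,y_1,\dots,y_k)]$, and let $S_{k+1}$ permute the $k+1$ coordinates). *)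

theory Defs
  imports "HOL-Algebra.Sym_Groups" "HOL-Algebra.Product_Groups" "HOL-Algebra.Bij"
begin

section \<open>The linear relaxation of the orthogonal array program\<close>

text \<open>
  A design is given by its rows: \<open>D j\<close> is the \<open>j\<close>-th row (for \<open>1 \<le> j \<le> 2^k\<close>) and
  \<open>D j i\<close> is its entry in column \<open>i\<close> (for \<open>1 \<le> i \<le> k\<close>). The order in which the elements
  of \<open>{1,-1}^k\<close> are listed is arbitrary.
\<close>

definition full_factorial :: "nat \<Rightarrow> (nat \<Rightarrow> nat \<Rightarrow> int) \<Rightarrow> bool" where
  "full_factorial k D \<longleftrightarrow> bij_betw D {1..2^k} ({1..k} \<rightarrow>\<^sub>E {1, -1})"

text \<open>
  The rows of the constraint matrix are indexed by the subsets \<open>I = {i\<^sub>1 < \<dots> < i\<^sub>j}\<close> of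
  \<open>{1..k}\<close> with at most \<open>t\<close> elements; row \<open>I\<close> is the Hadamard product of the columns
  \<open>i\<^sub>1, \<dots>, i\<^sub>j\<close> of the design. The empty set gives the all-ones row, which is the one with
  right-hand side \<open>N\<close>.
\<close>

definition oa_rows :: "nat \<Rightarrow> nat \<Rightarrow> nat set set" where
  "oa_rows k t = {I. I \<subseteq> {1..k} \<and> card I \<le> t}"

definition oa_matrix :: "(nat \<Rightarrow> nat \<Rightarrow> int) \<Rightarrow> nat set \<Rightarrow> nat \<Rightarrow> rat" where
  "oa_matrix D I j = (\<Prod>i\<in>I. of_int (D j i))"

definition oa_rhs :: "nat \<Rightarrow> nat set \<Rightarrow> rat" where
  "oa_rhs N I = (if I = {} then of_nat N else 0)"

text \<open>
  A vector of length \<open>n\<close> is a function that is extensional on \<open>{1..n}\<close>. The integer program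
  additionally requires integral entries; the relaxation drops this.
\<close>

definition oa_lp_feasible :: "nat \<Rightarrow> nat \<Rightarrow> nat \<Rightarrow> (nat \<Rightarrow> nat \<Rightarrow> int) \<Rightarrow> (nat \<Rightarrow> rat) set" where
  "oa_lp_feasible N k t D =
     {f \<in> {1..2^k} \<rightarrow>\<^sub>E {q. 0 \<le> q}.
        \<forall>I\<in>oa_rows k t. (\<Sum>j=1..2^k. oa_matrix D I j * f j) = oa_rhs N I}"

text \<open>
  The left action of a permutation on vectors moves the entry at position \<open>j\<close> to
  position \<open>\<pi> j\<close>.
\<close>

definition permute_vec :: "(nat \<Rightarrow> nat) \<Rightarrow> (nat \<Rightarrow> 'a) \<Rightarrow> nat \<Rightarrow> 'a" where
  "permute_vec \<pi> f = f \<circ> inv' \<pi>"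

definition feasible_symmetries :: "nat \<Rightarrow> (nat \<Rightarrow> 'a) set \<Rightarrow> (nat \<Rightarrow> nat) set" where
  "feasible_symmetries n F = {\<pi> \<in> carrier (sym_group n). \<forall>f\<in>F. permute_vec \<pi> f \<in> F}"

definition oa_G_LP :: "nat \<Rightarrow> nat \<Rightarrow> nat \<Rightarrow> (nat \<Rightarrow> nat \<Rightarrow> int) \<Rightarrow> (nat \<Rightarrow> nat) monoid" where
  "oa_G_LP N k t D =
     (sym_group (2^k))\<lparr>carrier := feasible_symmetries (2^k) (oa_lp_feasible N k t D)\<rparr>"

lemma permute_vec_comp:
  assumes "\<pi> permutes S" "\<tau> permutes S"
  shows "permute_vec (\<pi> \<circ> \<tau>) f = permute_vec \<pi> (permute_vec \<tau> f)"
  using assms by (simp add: permute_vec_def permutes_inv_o permutes_bij o_inv_distrib o_assoc)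

lemma subgroup_feasible_symmetries: "subgroup (feasible_symmetries n F) (sym_group n)"
proof -
  interpret S: group "sym_group n" by (rule sym_group_is_group)
  have closed: "\<pi> \<circ> \<tau> \<in> feasible_symmetries n F"
    if "\<pi> \<in> feasible_symmetries n F" "\<tau> \<in> feasible_symmetries n F" for \<pi> \<tau>
  proof -
    have p: "\<pi> permutes {1..n}" "\<tau> permutes {1..n}"
      using that by (auto simp: feasible_symmetries_def sym_group_carrier)
    show ?thesis
      unfolding feasible_symmetries_def mem_Collect_eq sym_group_carrier permute_vec_comp[OF p]
      using that permutes_compose[OF p(2,1)] by (simp add: feasible_symmetries_def)
  qed
  have one: "id \<in> feasible_symmetries n F"
    by (auto simp: feasible_symmetries_def sym_group_carrier permute_vec_def permutes_id)
  show ?thesis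
  proof (rule S.subgroupI)
    show "feasible_symmetries n F \<subseteq> carrier (sym_group n)"
      by (auto simp: feasible_symmetries_def)
    show "feasible_symmetries n F \<noteq> {}" using one by blast
  next
    fix \<pi> assume \<pi>: "\<pi> \<in> feasible_symmetries n F"
    then have perm: "\<pi> permutes {1..n}"
      by (auto simp: feasible_symmetries_def sym_group_carrier)
    have pow: "\<pi> ^^ m \<in> feasible_symmetries n F" for m
    proof (induction m)
      case 0
      then show ?case unfolding funpow.simps by (rule one)
    next
      case (Suc m)
      then show ?case unfolding funpow.simps by (rule closed[OF \<pi>])
    qed
    obtain m where m: "\<pi> ^^ m = id" "m > 0"
      using permutation_is_nilpotent perm permutation_permutes by (metis finite_atLeastAtMost)
    then have "\<pi> ^^ (m - 1) \<circ> \<pi> = id"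
      by (metis Suc_diff_1 funpow_Suc_right)
    then have "\<pi> ^^ (m - 1) \<otimes>\<^bsub>sym_group n\<^esub> \<pi> = \<one>\<^bsub>sym_group n\<^esub>"
      by (simp add: sym_group_def)
    then have "inv\<^bsub>sym_group n\<^esub> \<pi> = \<pi> ^^ (m - 1)"
      using S.inv_equality \<pi> pow by (simp add: feasible_symmetries_def)
    then show "inv\<^bsub>sym_group n\<^esub> \<pi> \<in> feasible_symmetries n F"
      using pow by simp
  next
    fix \<pi> \<tau> assume "\<pi> \<in> feasible_symmetries n F" "\<tau> \<in> feasible_symmetries n F"
    then show "\<pi> \<otimes>\<^bsub>sym_group n\<^esub> \<tau> \<in> feasible_symmetries n F"
      using closed by (simp add: sym_group_def)
  qed
qed

lemma group_oa_G_LP: "group (oa_G_LP N k t D)"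
  unfolding oa_G_LP_def
  by (rule subgroup.subgroup_is_group[OF subgroup_feasible_symmetries sym_group_is_group])


section \<open>Semidirect products\<close>

text \<open>The outer semidirect product of \<open>A\<close> by \<open>B\<close> along \<open>\<phi> : B \<rightarrow> Aut A\<close>.\<close>

definition semidirect_product ::
  "('a, 'm) monoid_scheme \<Rightarrow> ('b, 'n) monoid_scheme \<Rightarrow> ('b \<Rightarrow> 'a \<Rightarrow> 'a) \<Rightarrow> ('a \<times> 'b) monoid" where
  "semidirect_product A B \<phi> =
     \<lparr>carrier = carrier A \<times> carrier B,
      mult = (\<lambda>(a, b) (a', b'). (a \<otimes>\<^bsub>A\<^esub> \<phi> b a', b \<otimes>\<^bsub>B\<^esub> b')),
      one = (\<one>\<^bsub>A\<^esub>, \<one>\<^bsub>B\<^esub>)\<rparr>"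

lemma group_semidirect_product:
  assumes "group A" "group B" and \<phi>: "\<phi> \<in> hom B (AutoGroup A)"
  shows "group (semidirect_product A B \<phi>)"
proof -
  interpret A: group A by fact
  interpret B: group B by fact
  interpret Au: group "AutoGroup A" by (rule A.AutoGroup)
  have h: "group_hom B (AutoGroup A) \<phi>" by unfold_locales (rule \<phi>)
  have aut: "\<phi> b \<in> auto A" if "b \<in> carrier B" for b
    using group_hom.hom_closed[OF h that] by (simp add: AutoGroup_def)
  have cl: "\<phi> b a \<in> carrier A" if "b \<in> carrier B" "a \<in> carrier A" for a b
    using aut[OF that(1)] that(2) by (auto simp: auto_def hom_def)
  have mul: "\<phi> b (a \<otimes>\<^bsub>A\<^esub> a') = \<phi> b a \<otimes>\<^bsub>A\<^esub> \<phi> b a'"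
    if "b \<in> carrier B" "a \<in> carrier A" "a' \<in> carrier A" for a a' b
    using aut[OF that(1)] that(2,3) by (auto simp: auto_def hom_def)
  have comp: "\<phi> (b \<otimes>\<^bsub>B\<^esub> b') a = \<phi> b (\<phi> b' a)"
    if "b \<in> carrier B" "b' \<in> carrier B" "a \<in> carrier A" for a b b'
    using group_hom.hom_mult[OF h that(1,2)] aut[OF that(1)] aut[OF that(2)] that(3)
    by (simp add: AutoGroup_def BijGroup_def auto_def compose_def)
  have one: "\<phi> \<one>\<^bsub>B\<^esub> a = a" if "a \<in> carrier A" for a
    using group_hom.hom_one[OF h] that by (simp add: AutoGroup_def BijGroup_def)
  have unit: "\<phi> b \<one>\<^bsub>A\<^esub> = \<one>\<^bsub>A\<^esub>" if "b \<in> carrier B" for b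
    using mul[OF that, of "\<one>\<^bsub>A\<^esub>" "\<one>\<^bsub>A\<^esub>"] cl[OF that, of "\<one>\<^bsub>A\<^esub>"] by simp
  show ?thesis
  proof (rule groupI)
    fix x assume x: "x \<in> carrier (semidirect_product A B \<phi>)"
    obtain a b where ab: "x = (a, b)" "a \<in> carrier A" "b \<in> carrier B"
      using x by (auto simp: semidirect_product_def)
    let ?y = "(\<phi> (inv\<^bsub>B\<^esub> b) (inv\<^bsub>A\<^esub> a), inv\<^bsub>B\<^esub> b)"
    have "?y \<in> carrier (semidirect_product A B \<phi>)"
      using ab cl[of "inv\<^bsub>B\<^esub> b" "inv\<^bsub>A\<^esub> a"] B.inv_closed A.inv_closed
      by (simp add: semidirect_product_def)
    moreover have "?y \<otimes>\<^bsub>semidirect_product A B \<phi>\<^esub> x = \<one>\<^bsub>semidirect_product A B \<phi>\<^esub>"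
      using ab mul[symmetric, of "inv\<^bsub>B\<^esub> b" "inv\<^bsub>A\<^esub> a" a] unit[of "inv\<^bsub>B\<^esub> b"]
      by (simp add: semidirect_product_def)
    ultimately show "\<exists>y\<in>carrier (semidirect_product A B \<phi>).
        y \<otimes>\<^bsub>semidirect_product A B \<phi>\<^esub> x = \<one>\<^bsub>semidirect_product A B \<phi>\<^esub>" by blast
  qed (auto simp: semidirect_product_def cl mul comp one A.m_assoc B.m_assoc)
qed


section \<open>The action of the symmetric group on sign vectors\<close>

text \<open>The group \<open>S\<^sub>2^k\<close>, in the form \<open>{1,-1}^k\<close> with coordinates \<open>1, \<dots>, k\<close>.\<close>

definition sign_vectors :: "nat \<Rightarrow> (nat \<Rightarrow> int) monoid" where
  "sign_vectors k = product_group {1..k} (\<lambda>_. sign_img)"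

definition symmetric_group :: "'a set \<Rightarrow> ('a \<Rightarrow> 'a) monoid" where
  "symmetric_group A = \<lparr>carrier = {p. p permutes A}, mult = (\<circ>), one = id\<rparr>"

text \<open>
  The class of \<open>(1, y\<^sub>1, \<dots>, y\<^sub>k)\<close> modulo \<open>\<plusminus>(1, \<dots>, 1)\<close> is sent by \<open>\<sigma>\<close> to the class of the
  vector with \<open>i\<close>-th entry \<open>lift_sign y (inv' \<sigma> i)\<close> for \<open>0 \<le> i \<le> k\<close>. Its representative with
  \<open>0\<close>-th entry \<open>1\<close> is obtained by multiplying with \<open>lift_sign y (inv' \<sigma> 0)\<close>.
\<close>

definition lift_sign :: "(nat \<Rightarrow> int) \<Rightarrow> nat \<Rightarrow> int" where
  "lift_sign y i = (if i = 0 then 1 else y i)"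

definition sign_action :: "nat \<Rightarrow> (nat \<Rightarrow> nat) \<Rightarrow> (nat \<Rightarrow> int) \<Rightarrow> (nat \<Rightarrow> int)" where
  "sign_action k \<sigma> =
     (\<lambda>y\<in>carrier (sign_vectors k). \<lambda>i\<in>{1..k}. lift_sign y (inv' \<sigma> i) * lift_sign y (inv' \<sigma> 0))"

lemma carrier_sign_vectors: "carrier (sign_vectors k) = {1..k} \<rightarrow>\<^sub>E {1, -1}"
  by (auto simp: sign_vectors_def sign_img_def insert_commute)

lemma group_sign_vectors: "group (sign_vectors k)"
  by (simp add: sign_vectors_def sign_img_is_group)

lemma mult_sign_vectors:
  "y \<otimes>\<^bsub>sign_vectors k\<^esub> z = (\<lambda>i\<in>{1..k}. y i * z i)"
  by (simp add: sign_vectors_def sign_img_def)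

lemma group_symmetric_group: "group (symmetric_group A)"
proof (rule groupI)
  fix x assume "x \<in> carrier (symmetric_group A)"
  then show "\<exists>y\<in>carrier (symmetric_group A). y \<otimes>\<^bsub>symmetric_group A\<^esub> x = \<one>\<^bsub>symmetric_group A\<^esub>"
    by (auto simp: symmetric_group_def intro!: exI[of _ "inv' x"] permutes_inv permutes_inv_o)
qed (auto simp: symmetric_group_def permutes_compose permutes_id o_assoc)

lemma lift_sign_cases:
  assumes "y \<in> carrier (sign_vectors k)" "i \<le> k"
  shows "lift_sign y i = 1 \<or> lift_sign y i = -1"
  using assms unfolding carrier_sign_vectors lift_sign_def
  by (cases "i = 0") (use PiE_mem in fastforce)+

lemma lift_sign_square:
  assumes "y \<in> carrier (sign_vectors k)" "i \<le> k"
  shows "lift_sign y i * lift_sign y i = 1"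
  using lift_sign_cases[OF assms] by auto

lemma permutes_inv_le:
  assumes "\<sigma> permutes {0..k}" "i \<le> (k::nat)"
  shows "inv' \<sigma> i \<le> k"
  using permutes_in_image[OF permutes_inv[OF assms(1)], of i] assms(2) by simp

lemma sign_action_closed:
  assumes "\<sigma> permutes {0..k}" "y \<in> carrier (sign_vectors k)"
  shows "sign_action k \<sigma> y \<in> carrier (sign_vectors k)"
proof -
  have "lift_sign y (inv' \<sigma> i) * lift_sign y (inv' \<sigma> 0) \<in> {1, -1}" if "i \<le> k" for i
    using lift_sign_cases[OF assms(2) permutes_inv_le[OF assms(1) that]]
      lift_sign_cases[OF assms(2) permutes_inv_le[OF assms(1), of 0]] by auto
  then show ?thesis
    using assms(2) by (auto simp: sign_action_def carrier_sign_vectors[of k])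
qed

lemma lift_sign_action:
  assumes "\<sigma> permutes {0..k}" "y \<in> carrier (sign_vectors k)" "i \<le> k"
  shows "lift_sign (sign_action k \<sigma> y) i = lift_sign y (inv' \<sigma> i) * lift_sign y (inv' \<sigma> 0)"
proof (cases "i = 0")
  case True
  then show ?thesis
    using lift_sign_square[OF assms(2) permutes_inv_le[OF assms(1), of 0]]
    by (simp add: lift_sign_def[of "sign_action k \<sigma> y"])
next
  case False
  then show ?thesis
    using assms by (simp add: lift_sign_def[of "sign_action k \<sigma> y"])
      (simp add: sign_action_def)
qed

lemma sign_action_comp:
  assumes \<sigma>: "\<sigma> permutes {0..k}" and \<tau>: "\<tau> permutes {0..k}"
    and y: "y \<in> carrier (sign_vectors k)"
  shows "sign_action k (\<sigma> \<circ> \<tau>) y = sign_action k \<sigma> (sign_action k \<tau> y)"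
proof
  fix i
  have inv: "inv' (\<sigma> \<circ> \<tau>) j = inv' \<tau> (inv' \<sigma> j)" for j
    using o_inv_distrib[OF permutes_bij[OF \<sigma>] permutes_bij[OF \<tau>]] by simp
  note sq = lift_sign_square[OF y permutes_inv_le[OF \<tau>, of 0]]
  have "lift_sign y (inv' \<tau> (inv' \<sigma> i)) * lift_sign y (inv' \<tau> (inv' \<sigma> 0)) =
      lift_sign y (inv' \<tau> (inv' \<sigma> i)) * lift_sign y (inv' \<tau> (inv' \<sigma> 0)) *
      (lift_sign y (inv' \<tau> 0) * lift_sign y (inv' \<tau> 0))"
    using sq by simp
  then show "sign_action k (\<sigma> \<circ> \<tau>) y i = sign_action k \<sigma> (sign_action k \<tau> y) i"
    using lift_sign_action[OF \<tau> y permutes_inv_le[OF \<sigma>, of i]]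
      lift_sign_action[OF \<tau> y permutes_inv_le[OF \<sigma>, of 0]]
      y sign_action_closed[OF \<tau> y] inv
    by (simp add: sign_action_def[of k \<sigma>] sign_action_def[of k "\<sigma> \<circ> \<tau>"] restrict_def mult_ac)
qed

lemma sign_action_id:
  assumes "y \<in> carrier (sign_vectors k)"
  shows "sign_action k id y = y"
  using assms
  by (auto simp: sign_action_def lift_sign_def carrier_sign_vectors[of k] PiE_def
      extensional_def fun_eq_iff)

lemma sign_action_auto:
  assumes \<sigma>: "\<sigma> permutes {0..k}"
  shows "sign_action k \<sigma> \<in> auto (sign_vectors k)"
proof -
  let ?C = "carrier (sign_vectors k)"
  interpret V: group "sign_vectors k" by (rule group_sign_vectors)
  have lift_mult: "lift_sign (y \<otimes>\<^bsub>sign_vectors k\<^esub> z) i = lift_sign y i * lift_sign z i"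
    if "i \<le> k" for y z i
    using that by (simp add: mult_sign_vectors lift_sign_def)
  have "sign_action k \<sigma> \<in> hom (sign_vectors k) (sign_vectors k)"
  proof (rule homI)
    fix y z assume yz: "y \<in> ?C" "z \<in> ?C"
    show "sign_action k \<sigma> (y \<otimes>\<^bsub>sign_vectors k\<^esub> z) =
        sign_action k \<sigma> y \<otimes>\<^bsub>sign_vectors k\<^esub> sign_action k \<sigma> z"
    proof
      fix i
      have "y \<otimes>\<^bsub>sign_vectors k\<^esub> z \<in> ?C" using yz by simp
      then show "sign_action k \<sigma> (y \<otimes>\<^bsub>sign_vectors k\<^esub> z) i =
          (sign_action k \<sigma> y \<otimes>\<^bsub>sign_vectors k\<^esub> sign_action k \<sigma> z) i"
        unfolding mult_sign_vectors[of _ "sign_action k \<sigma> y"]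
        using yz lift_mult[OF permutes_inv_le[OF \<sigma>, of i], of y z]
          lift_mult[OF permutes_inv_le[OF \<sigma>, of 0], of y z]
        by (simp add: sign_action_def restrict_def mult_ac)
    qed
  qed (rule sign_action_closed[OF \<sigma>])
  moreover have "bij_betw (sign_action k \<sigma>) ?C ?C"
  proof (rule bij_betw_byWitness[where f' = "sign_action k (inv' \<sigma>)"])
    note inv = permutes_inv[OF \<sigma>]
    show "\<forall>y\<in>?C. sign_action k (inv' \<sigma>) (sign_action k \<sigma> y) = y"
      using sign_action_comp[OF inv \<sigma>] sign_action_id permutes_inv_o(2)[OF \<sigma>] by simp
    show "\<forall>y\<in>?C. sign_action k \<sigma> (sign_action k (inv' \<sigma>) y) = y"
      using sign_action_comp[OF \<sigma> inv] sign_action_id permutes_inv_o(1)[OF \<sigma>] by simp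
    show "sign_action k \<sigma> ` ?C \<subseteq> ?C" using sign_action_closed[OF \<sigma>] by blast
    show "sign_action k (inv' \<sigma>) ` ?C \<subseteq> ?C" using sign_action_closed[OF inv] by blast
  qed
  ultimately show ?thesis
    by (simp add: auto_def Bij_def sign_action_def)
qed

lemma sign_action_hom:
  "sign_action k \<in> hom (symmetric_group {0..k}) (AutoGroup (sign_vectors k))"
proof (rule homI)
  fix \<sigma> assume "\<sigma> \<in> carrier (symmetric_group {0..k})"
  then show "sign_action k \<sigma> \<in> carrier (AutoGroup (sign_vectors k))"
    using sign_action_auto by (simp add: AutoGroup_def symmetric_group_def)
next
  fix \<sigma> \<tau> assume "\<sigma> \<in> carrier (symmetric_group {0..k})" "\<tau> \<in> carrier (symmetric_group {0..k})"
  then have p: "\<sigma> permutes {0..k}" "\<tau> permutes {0..k}"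
    by (auto simp: symmetric_group_def)
  have "sign_action k (\<sigma> \<circ> \<tau>) = compose (carrier (sign_vectors k)) (sign_action k \<sigma>) (sign_action k \<tau>)"
    (is "?l = ?r")
  proof (rule extensionalityI)
    show "?l \<in> extensional (carrier (sign_vectors k))" by (simp add: sign_action_def)
    show "?r \<in> extensional (carrier (sign_vectors k))" by (simp add: compose_def)
  qed (simp add: sign_action_comp[OF p] compose_def)
  then show "sign_action k (\<sigma> \<otimes>\<^bsub>symmetric_group {0..k}\<^esub> \<tau>) =
      sign_action k \<sigma> \<otimes>\<^bsub>AutoGroup (sign_vectors k)\<^esub> sign_action k \<tau>"
    using sign_action_auto[OF p(1)] sign_action_auto[OF p(2)]
    by (simp add: AutoGroup_def BijGroup_def symmetric_group_def auto_def)
qed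

lemma sign_action_transposition:
  assumes "i \<in> {1..k}" "y \<in> carrier (sign_vectors k)"
  shows "sign_action k (transpose 0 i) y = (\<lambda>j\<in>{1..k}. if j = i then y i else y j * y i)"
  using assms
  by (auto simp: sign_action_def lift_sign_def transpose_def restrict_def fun_eq_iff)

lemma group_semidirect_sign:
  "group (semidirect_product (sign_vectors k) (symmetric_group {0..k}) (sign_action k))"
  by (rule group_semidirect_product[OF group_sign_vectors group_symmetric_group sign_action_hom])

end

theory Submission
  imports Defs
begin

text \<open>
  The uniform vector is a strictly positive feasible point, so a permutation is a symmetry of the
  relaxation iff it preserves the span of the monomials of degree at most two, that is, iff it
  preserves the reproducing kernel of that span. Lifting sign vectors to \<open>k + 1\<close> coordinates modulo
  sign, this kernel is an affine function of the squared inner product, so the symmetries are the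
  maps that preserve the distance of the folded cube. After composition with an affine map such a
  map fixes the identity and its neighbours. Squared inner products with these determine every
  vector that is not balanced; the balanced ones are determined by the vectors at distance two from
  the identity, which are not balanced themselves as \<open>k + 1 \<noteq> 4\<close>.
\<close>

section \<open>Sign vectors and their pairing\<close>

text \<open>The inner product of the representatives with 0-th entry 1. Another choice of
  representatives may change its sign, so only its square is a function of the classes.\<close>

definition pairing :: "nat \<Rightarrow> (nat \<Rightarrow> int) \<Rightarrow> (nat \<Rightarrow> int) \<Rightarrow> int" where
  "pairing k u v = (\<Sum>i=0..k. lift_sign u i * lift_sign v i)"

text \<open>The unit vector at coordinate \<open>c\<close> of \<open>{1,-1}^(k+1)\<close> modulo \<open>\<plusminus>(1, \<dots>, 1)\<close>; for \<open>c = 0\<close> its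
  representative with \<open>0\<close>-th entry \<open>1\<close> has all other entries \<open>-1\<close>.\<close>

definition flip :: "nat \<Rightarrow> nat \<Rightarrow> nat \<Rightarrow> int" where
  "flip k c = (\<lambda>i\<in>{1..k}. if c = 0 \<or> i = c then -1 else 1)"

text \<open>The unit vector at \<open>c\<close> before normalisation; the factor
  \<open>sign_at c 0\<close> that accompanies it below brings the 0-th entry back to 1.\<close>

definition sign_at :: "nat \<Rightarrow> nat \<Rightarrow> int" where
  "sign_at c i = (if i = c then -1 else 1)"

text \<open>Permuting first and translating afterwards is the order that makes composition agree
  with the semidirect multiplication.\<close>

definition sign_affine :: "nat \<Rightarrow> (nat \<Rightarrow> int) \<times> (nat \<Rightarrow> nat) \<Rightarrow> (nat \<Rightarrow> int) \<Rightarrow> nat \<Rightarrow> int" where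
  "sign_affine k = (\<lambda>(a, \<sigma>) v. a \<otimes>\<^bsub>sign_vectors k\<^esub> sign_action k \<sigma> v)"

lemma one_sign_vectors: "\<one>\<^bsub>sign_vectors k\<^esub> = (\<lambda>i\<in>{1..k}. 1)"
  by (simp add: sign_vectors_def sign_img_def)

lemma mult_closed_sign_vectors:
  assumes "u \<in> carrier (sign_vectors k)" "v \<in> carrier (sign_vectors k)"
  shows "u \<otimes>\<^bsub>sign_vectors k\<^esub> v \<in> carrier (sign_vectors k)"
  using assms group.is_monoid[OF group_sign_vectors] by (simp add: monoid.m_closed)

lemma one_closed_sign_vectors: "\<one>\<^bsub>sign_vectors k\<^esub> \<in> carrier (sign_vectors k)"
  using group.is_monoid[OF group_sign_vectors] by (simp add: monoid.one_closed)

lemma flip_closed: "flip k c \<in> carrier (sign_vectors k)"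
  by (auto simp: carrier_sign_vectors flip_def)

lemma lift_sign_mult:
  "i \<le> k \<Longrightarrow> lift_sign (u \<otimes>\<^bsub>sign_vectors k\<^esub> v) i = lift_sign u i * lift_sign v i"
  by (simp add: mult_sign_vectors lift_sign_def)

lemma lift_sign_one: "i \<le> k \<Longrightarrow> lift_sign \<one>\<^bsub>sign_vectors k\<^esub> i = 1"
  by (simp add: one_sign_vectors lift_sign_def)

lemma lift_sign_0: "lift_sign v 0 = 1"
  by (simp add: lift_sign_def)

lemma lift_sign_flip: "i \<le> k \<Longrightarrow> lift_sign (flip k c) i = sign_at c i * sign_at c 0"
  by (auto simp: flip_def lift_sign_def sign_at_def)

lemma sign_vectors_eqI:
  assumes "u \<in> carrier (sign_vectors k)" "v \<in> carrier (sign_vectors k)"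
    and eq: "\<And>i. i \<le> k \<Longrightarrow> lift_sign u i = lift_sign v i"
  shows "u = v"
proof (rule PiE_ext)
  show "u \<in> {1..k} \<rightarrow>\<^sub>E {1, -1}" "v \<in> {1..k} \<rightarrow>\<^sub>E {1, -1}"
    using assms by (simp_all add: carrier_sign_vectors)
  show "u i = v i" if "i \<in> {1..k}" for i
    using eq[of i] that by (simp add: lift_sign_def split: if_splits)
qed

lemma sign_mult_cancel:
  assumes "a \<in> carrier (sign_vectors k)" "v \<in> carrier (sign_vectors k)"
  shows "a \<otimes>\<^bsub>sign_vectors k\<^esub> (a \<otimes>\<^bsub>sign_vectors k\<^esub> v) = v"
  using assms lift_sign_square[OF assms(1)]
  by (intro sign_vectors_eqI)
     (auto simp: mult_closed_sign_vectors lift_sign_mult mult.assoc[symmetric])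

lemma finite_sign_vectors: "finite (carrier (sign_vectors k))"
  by (simp add: carrier_sign_vectors finite_PiE)

lemma card_sign_vectors: "card (carrier (sign_vectors k)) = 2 ^ k"
  by (simp add: carrier_sign_vectors card_PiE numeral_2_eq_2)

lemma pairing_commute: "pairing k u v = pairing k v u"
  by (simp add: pairing_def mult.commute)

section \<open>Values and invariance of the pairing\<close>

lemma pairing_self:
  assumes "v \<in> carrier (sign_vectors k)"
  shows "pairing k v v = int k + 1"
  using lift_sign_square[OF assms] by (simp add: pairing_def)

lemma pairing_mult_left:
  assumes "a \<in> carrier (sign_vectors k)"
  shows "pairing k (a \<otimes>\<^bsub>sign_vectors k\<^esub> u) (a \<otimes>\<^bsub>sign_vectors k\<^esub> v) = pairing k u v"
  unfolding pairing_def
proof (rule sum.cong[OF refl])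
  fix i assume "i \<in> {0..k}"
  then have i: "i \<le> k" by simp
  have "lift_sign (a \<otimes>\<^bsub>sign_vectors k\<^esub> u) i * lift_sign (a \<otimes>\<^bsub>sign_vectors k\<^esub> v) i =
      (lift_sign a i * lift_sign a i) * (lift_sign u i * lift_sign v i)"
    using i by (simp add: lift_sign_mult)
  then show "lift_sign (a \<otimes>\<^bsub>sign_vectors k\<^esub> u) i * lift_sign (a \<otimes>\<^bsub>sign_vectors k\<^esub> v) i =
      lift_sign u i * lift_sign v i"
    using lift_sign_square[OF assms i] by simp
qed

text \<open>Renormalising the 0-th entries multiplies every summand by the same sign
  \<open>?s\<close>, which squaring removes.\<close>

lemma pairing_sign_action:
  assumes \<sigma>: "\<sigma> permutes {0..k}"
    and u: "u \<in> carrier (sign_vectors k)" and v: "v \<in> carrier (sign_vectors k)"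
  shows "(pairing k (sign_action k \<sigma> u) (sign_action k \<sigma> v))\<^sup>2 = (pairing k u v)\<^sup>2"
proof -
  let ?s = "lift_sign u (inv' \<sigma> 0) * lift_sign v (inv' \<sigma> 0)"
  have "pairing k (sign_action k \<sigma> u) (sign_action k \<sigma> v) =
      (\<Sum>i=0..k. ?s * (lift_sign u (inv' \<sigma> i) * lift_sign v (inv' \<sigma> i)))"
    unfolding pairing_def
    by (rule sum.cong[OF refl]) (simp add: lift_sign_action[OF \<sigma> u] lift_sign_action[OF \<sigma> v])
  also have "\<dots> = ?s * pairing k u v"
    using sum.permute[OF permutes_inv[OF \<sigma>], of "\<lambda>i. lift_sign u i * lift_sign v i"]
    by (simp add: pairing_def sum_distrib_left comp_def)
  finally show ?thesis
    using lift_sign_cases[OF u permutes_inv_le[OF \<sigma>, of 0]]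
      lift_sign_cases[OF v permutes_inv_le[OF \<sigma>, of 0]] by auto
qed

text \<open>Only the summand at \<open>c\<close> changes sign, which costs twice that summand; the
  outer sign comes from the normalisation of \<open>flip k c\<close>.\<close>

lemma pairing_mult_flip:
  assumes "c \<le> k"
  shows "pairing k v (a \<otimes>\<^bsub>sign_vectors k\<^esub> flip k c) =
    sign_at c 0 * (pairing k v a - 2 * (lift_sign v c * lift_sign a c))"
proof -
  let ?g = "\<lambda>i. lift_sign v i * lift_sign a i"
  have "pairing k v (a \<otimes>\<^bsub>sign_vectors k\<^esub> flip k c) = (\<Sum>i=0..k. sign_at c 0 * (?g i * sign_at c i))"
    unfolding pairing_def by (rule sum.cong[OF refl]) (simp add: lift_sign_mult lift_sign_flip)
  also have "\<dots> = sign_at c 0 * (\<Sum>i=0..k. ?g i - (if i = c then 2 * ?g i else 0))"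
    unfolding sum_distrib_left by (rule sum.cong[OF refl]) (simp add: sign_at_def)
  finally show ?thesis
    using assms by (simp add: pairing_def sum_subtractf)
qed

lemma pairing_flip:
  assumes "c \<le> k"
  shows "pairing k v (flip k c) =
    sign_at c 0 * (pairing k v \<one>\<^bsub>sign_vectors k\<^esub> - 2 * lift_sign v c)"
  using pairing_mult_flip[OF assms, of v "\<one>\<^bsub>sign_vectors k\<^esub>"] assms
    monoid.l_one[OF group.is_monoid[OF group_sign_vectors] flip_closed]
  by (simp add: lift_sign_one)

lemma sign_at_square: "(sign_at c i)\<^sup>2 = 1"
  by (simp add: sign_at_def)

section \<open>Maps of sign vectors preserving the squared pairing\<close>

lemma sign_action_flip:
  assumes \<sigma>: "\<sigma> permutes {0..k}" and c: "c \<le> k"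
  shows "sign_action k \<sigma> (flip k c) = flip k (\<sigma> c)"
proof (rule sign_vectors_eqI)
  fix i assume i: "i \<le> k"
  have "sign_at c (inv' \<sigma> j) = sign_at (\<sigma> c) j" for j
    using permutes_inverses[OF \<sigma>] by (auto simp: sign_at_def)
  then show "lift_sign (sign_action k \<sigma> (flip k c)) i = lift_sign (flip k (\<sigma> c)) i"
    using i permutes_inv_le[OF \<sigma>, of i] permutes_inv_le[OF \<sigma>, of 0]
    by (simp add: lift_sign_action[OF \<sigma> flip_closed] lift_sign_flip sign_at_def)
qed (simp_all add: flip_closed sign_action_closed[OF \<sigma>])

text \<open>Before normalisation, two distinct unit vectors disagree in exactly two of the k + 1
  coordinates, so up to sign their pairing is (k + 1) - 4.\<close>

lemma pairing_flip_flip: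
  assumes "c \<le> k" "d \<le> k" "c \<noteq> d"
  shows "(pairing k (flip k c) (flip k d))\<^sup>2 = (int k - 3)\<^sup>2"
proof -
  have one: "pairing k (flip k c) \<one>\<^bsub>sign_vectors k\<^esub> = sign_at c 0 * (int k - 1)"
    using pairing_flip[OF assms(1), of "\<one>\<^bsub>sign_vectors k\<^esub>"] assms(1)
    by (simp add: lift_sign_one pairing_self one_closed_sign_vectors pairing_commute[of k "flip k c"])
  have d: "lift_sign (flip k c) d = sign_at c 0"
    using assms by (simp add: lift_sign_flip sign_at_def)
  have "pairing k (flip k c) (flip k d) = sign_at d 0 * sign_at c 0 * (int k - 3)"
    unfolding pairing_flip[OF assms(2)] one d by (simp add: algebra_simps)
  then show ?thesis by (simp add: power_mult_distrib sign_at_square)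
qed

lemma flip_inj:
  assumes "k \<ge> 2" "c \<le> k" "d \<le> k" "flip k c = flip k d"
  shows "c = d"
proof (rule ccontr)
  assume "c \<noteq> d"
  then have "(int k + 1)\<^sup>2 = (int k - 3)\<^sup>2"
    using pairing_flip_flip[OF assms(2,3)] assms(4) by (simp add: pairing_self flip_closed)
  \<comment> \<open>Equal squares mean equal bases up to sign, and \<open>k + 1 = 3 - k\<close>
    would force \<open>k = 1\<close>.\<close>
  then show False using assms(1) by (simp add: power2_eq_iff)
qed

text \<open>The pairing with the identity is the number of entries 1 minus the number of entries -1
  among k + 1 coordinates, so this value leaves a single entry of one of the two signs.\<close>

lemma eq_flip_if_pairing_one:
  assumes v: "v \<in> carrier (sign_vectors k)"
    and eq: "(pairing k \<one>\<^bsub>sign_vectors k\<^esub> v)\<^sup>2 = (int k - 1)\<^sup>2"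
  shows "\<exists>c\<le>k. v = flip k c"
proof -
  define A where "A = {i \<in> {0..k}. lift_sign v i = -1}"
  define B where "B = {i \<in> {0..k}. lift_sign v i = 1}"
  have AB: "A \<union> B = {0..k}" "A \<inter> B = {}" and fin: "finite A" "finite B"
    unfolding A_def B_def using lift_sign_cases[OF v] by fastforce+
  have card: "card A + card B = k + 1"
    using card_Un_disjoint[OF fin AB(2)] AB(1) by simp
  have "pairing k \<one>\<^bsub>sign_vectors k\<^esub> v = (\<Sum>i\<in>A \<union> B. lift_sign v i)"
    unfolding AB(1) pairing_def by (rule sum.cong[OF refl]) (simp add: lift_sign_one)
  also have "\<dots> = (\<Sum>i\<in>A. -1) + (\<Sum>i\<in>B. 1)"
    unfolding sum.union_disjoint[OF fin AB(2)] by (simp add: A_def B_def)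
  finally have "pairing k \<one>\<^bsub>sign_vectors k\<^esub> v = int (card B) - int (card A)" by simp
  then have "card A = 1 \<or> card B = 1"
    using eq card unfolding power2_eq_iff by linarith
  then show ?thesis
  proof
    assume "card A = 1"
    then obtain c where c: "A = {c}" using card_1_singletonE by blast
    have "c \<in> A" using c by simp
    then have "c \<le> k" "c \<noteq> 0" by (auto simp: A_def lift_sign_def split: if_splits)
    moreover have "v = flip k c"
    proof (rule sign_vectors_eqI[OF v flip_closed])
      fix i assume i: "i \<le> k"
      have "i \<in> A \<longleftrightarrow> i = c" using c by simp
      then show "lift_sign v i = lift_sign (flip k c) i"
        using i \<open>c \<noteq> 0\<close> lift_sign_cases[OF v i] by (auto simp: A_def lift_sign_flip sign_at_def)
    qed
    ultimately show ?thesis by blast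
  next
    assume "card B = 1"
    \<comment> \<open>By normalisation the lone entry 1 can only be the one at coordinate 0, which
      is the unit vector at 0.\<close>
    moreover have "0 \<in> B" by (simp add: B_def lift_sign_0)
    ultimately have B: "B = {0}" using card_1_singletonE by blast
    have "v = flip k 0"
    proof (rule sign_vectors_eqI[OF v flip_closed])
      fix i assume i: "i \<le> k"
      have "i \<in> B \<longleftrightarrow> i = 0" using B by simp
      then show "lift_sign v i = lift_sign (flip k 0) i"
        using i lift_sign_cases[OF v i] by (auto simp: B_def lift_sign_flip sign_at_def)
    qed
    then show ?thesis by blast
  qed
qed

text \<open>If \<open>s\<close> is the pairing of \<open>v\<close> with the identity, its pairing
  with a unit vector is \<open>s - 2 * lift_sign v c\<close> up to sign. Once the square of
  \<open>s\<close> is known, the square of this reveals exactly the product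
  \<open>s * lift_sign v c\<close>, from which the entry is recovered when \<open>s\<close> is
  nonzero.\<close>

lemma sign_vectors_eq_if_pairings:
  assumes v: "v \<in> carrier (sign_vectors k)" and w: "w \<in> carrier (sign_vectors k)"
    and one: "(pairing k v \<one>\<^bsub>sign_vectors k\<^esub>)\<^sup>2 = (pairing k w \<one>\<^bsub>sign_vectors k\<^esub>)\<^sup>2"
    and flip: "\<And>c. c \<le> k \<Longrightarrow> (pairing k v (flip k c))\<^sup>2 = (pairing k w (flip k c))\<^sup>2"
    and nz: "pairing k v \<one>\<^bsub>sign_vectors k\<^esub> \<noteq> 0"
  shows "v = w"
proof (rule sign_vectors_eqI[OF v w])
  define s t where "s = pairing k v \<one>\<^bsub>sign_vectors k\<^esub>" and "t = pairing k w \<one>\<^bsub>sign_vectors k\<^esub>"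
  have eq: "s * lift_sign v c = t * lift_sign w c" if c: "c \<le> k" for c
  proof -
    have "(s - 2 * lift_sign v c)\<^sup>2 = (t - 2 * lift_sign w c)\<^sup>2"
      using flip[OF c] by (simp add: pairing_flip[OF c] s_def t_def power_mult_distrib sign_at_square)
    moreover have "(lift_sign v c)\<^sup>2 = (lift_sign w c)\<^sup>2"
      using lift_sign_square[OF v c] lift_sign_square[OF w c] by (simp add: power2_eq_square)
    ultimately show ?thesis
      using one by (simp add: s_def[symmetric] t_def[symmetric] power2_diff power_mult_distrib)
  qed
  \<comment> \<open>Both 0-th entries are 1, which settles the relative sign of \<open>s\<close> and
    \<open>t\<close>.\<close>
  have "s = t" using eq[of 0] by (simp add: lift_sign_0)
  then show "lift_sign v i = lift_sign w i" if "i \<le> k" for i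
    using eq[OF that] nz by (simp add: s_def)
qed

lemma pairing_isometry_fixing_flips:
  assumes k: "k \<ge> 2" "k \<noteq> 3"
    and closed: "\<And>v. v \<in> carrier (sign_vectors k) \<Longrightarrow> \<phi> v \<in> carrier (sign_vectors k)"
    and iso: "\<And>u v. u \<in> carrier (sign_vectors k) \<Longrightarrow> v \<in> carrier (sign_vectors k) \<Longrightarrow>
      (pairing k (\<phi> u) (\<phi> v))\<^sup>2 = (pairing k u v)\<^sup>2"
    and one: "\<phi> \<one>\<^bsub>sign_vectors k\<^esub> = \<one>\<^bsub>sign_vectors k\<^esub>"
    and flip: "\<And>c. c \<le> k \<Longrightarrow> \<phi> (flip k c) = flip k c"
    and v: "v \<in> carrier (sign_vectors k)"
  shows "\<phi> v = v"
proof -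
  let ?V = "carrier (sign_vectors k)"
  have nz: "\<phi> u = u" if u: "u \<in> ?V" and nz: "pairing k u \<one>\<^bsub>sign_vectors k\<^esub> \<noteq> 0" for u
    using sign_vectors_eq_if_pairings[OF u closed[OF u] _ _ nz]
      iso[OF u one_closed_sign_vectors] iso[OF u flip_closed] one flip by metis
  show ?thesis
  proof (cases "pairing k v \<one>\<^bsub>sign_vectors k\<^esub> = 0")
    case False
    then show ?thesis by (rule nz[OF v])
  next
    case True
    \<comment> \<open>The vectors at distance two from the identity are fixed, and they separate
      the balanced vectors, which the unit vectors do not.\<close>
    let ?e = "\<lambda>c. flip k 0 \<otimes>\<^bsub>sign_vectors k\<^esub> flip k c"
    have e: "?e c \<in> ?V" for c by (simp add: mult_closed_sign_vectors flip_closed)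
    have p0: "pairing k u (flip k 0) = 2 - pairing k u \<one>\<^bsub>sign_vectors k\<^esub>" for u
      using pairing_flip[of 0 k u] by (simp add: sign_at_def lift_sign_0)
    \<comment> \<open>The normalised representative of \<open>?e c\<close> is 1 at 0 and at
      \<open>c\<close>, and -1 elsewhere.\<close>
    have pc: "pairing k u (?e c) = 2 - pairing k u \<one>\<^bsub>sign_vectors k\<^esub> + 2 * lift_sign u c"
      if "1 \<le> c" "c \<le> k" for u c
      using pairing_mult_flip[OF that(2), of u "flip k 0"] that
      by (simp add: p0 lift_sign_flip sign_at_def)
    have fix_e: "\<phi> (?e c) = ?e c" if c: "1 \<le> c" "c \<le> k" for c
    proof (rule nz[OF e])
      \<comment> \<open>The excluded value \<open>k = 3\<close> is the one for which
        \<open>?e c\<close> would be balanced.\<close>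
      have "pairing k \<one>\<^bsub>sign_vectors k\<^esub> (?e c) = 3 - int k"
        using c by (simp add: pc pairing_self one_closed_sign_vectors lift_sign_one)
      then show "pairing k (?e c) \<one>\<^bsub>sign_vectors k\<^esub> \<noteq> 0"
        using k(2) by (simp add: pairing_commute)
    qed
    have w0: "pairing k (\<phi> v) \<one>\<^bsub>sign_vectors k\<^esub> = 0"
      using iso[OF v one_closed_sign_vectors] one True by simp
    show ?thesis
    proof (rule sign_vectors_eqI[OF closed[OF v] v])
      fix i assume i: "i \<le> k"
      show "lift_sign (\<phi> v) i = lift_sign v i"
      proof (cases "i = 0")
        case False
        \<comment> \<open>For a balanced vector the pairing with \<open>?e i\<close> is 4 or 0
          according to its entry at \<open>i\<close>, and these two values have different
          squares.\<close>
        then have "(2 + 2 * lift_sign (\<phi> v) i)\<^sup>2 = (2 + 2 * lift_sign v i)\<^sup>2"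
          using iso[OF v e[of i]] i fix_e[of i] pc[of i] True w0 by simp
        then show ?thesis
          using lift_sign_cases[OF v i] lift_sign_cases[OF closed[OF v] i] by auto
      qed (simp add: lift_sign_0)
    qed
  qed
qed

section \<open>Affine maps and the classification of the isometries\<close>

lemma sign_affine_closed:
  assumes "a \<in> carrier (sign_vectors k)" "\<sigma> permutes {0..k}" "v \<in> carrier (sign_vectors k)"
  shows "sign_affine k (a, \<sigma>) v \<in> carrier (sign_vectors k)"
  using assms by (simp add: sign_affine_def mult_closed_sign_vectors sign_action_closed)

lemma pairing_sign_affine:
  assumes "a \<in> carrier (sign_vectors k)" "\<sigma> permutes {0..k}"
    "u \<in> carrier (sign_vectors k)" "v \<in> carrier (sign_vectors k)"
  shows "(pairing k (sign_affine k (a, \<sigma>) u) (sign_affine k (a, \<sigma>) v))\<^sup>2 = (pairing k u v)\<^sup>2"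
  using assms by (simp add: sign_affine_def pairing_mult_left pairing_sign_action)

lemma sign_action_one:
  assumes "\<sigma> permutes {0..k}"
  shows "sign_action k \<sigma> \<one>\<^bsub>sign_vectors k\<^esub> = \<one>\<^bsub>sign_vectors k\<^esub>"
proof (rule sign_vectors_eqI)
  fix i assume "i \<le> k"
  then show "lift_sign (sign_action k \<sigma> \<one>\<^bsub>sign_vectors k\<^esub>) i = lift_sign \<one>\<^bsub>sign_vectors k\<^esub> i"
    using permutes_inv_le[OF assms, of i] permutes_inv_le[OF assms, of 0]
    by (simp add: lift_sign_action[OF assms one_closed_sign_vectors] lift_sign_one)
qed (simp_all add: one_closed_sign_vectors sign_action_closed[OF assms])

text \<open>The translation is read off from the image of the identity and the coordinate
  permutation from the images of the unit vectors. Undoing both leaves an isometry that fixes all of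
  these, hence every sign vector.\<close>

lemma pairing_isometry_is_affine:
  assumes k: "k \<ge> 2" "k \<noteq> 3"
    and closed: "\<And>v. v \<in> carrier (sign_vectors k) \<Longrightarrow> \<phi> v \<in> carrier (sign_vectors k)"
    and iso: "\<And>u v. u \<in> carrier (sign_vectors k) \<Longrightarrow> v \<in> carrier (sign_vectors k) \<Longrightarrow>
      (pairing k (\<phi> u) (\<phi> v))\<^sup>2 = (pairing k u v)\<^sup>2"
  shows "\<exists>a\<in>carrier (sign_vectors k). \<exists>\<sigma>. \<sigma> permutes {0..k} \<and>
    (\<forall>v\<in>carrier (sign_vectors k). \<phi> v = sign_affine k (a, \<sigma>) v)"
proof -
  let ?V = "carrier (sign_vectors k)" and ?one = "\<one>\<^bsub>sign_vectors k\<^esub>"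
  interpret V: group "sign_vectors k" by (rule group_sign_vectors)
  define a where "a = \<phi> ?one"
  have a: "a \<in> ?V" unfolding a_def by (rule closed) simp
  \<comment> \<open>Since \<open>a\<close> is its own inverse, multiplying by it undoes the
    translation.\<close>
  define \<psi> where "\<psi> = (\<lambda>v. a \<otimes>\<^bsub>sign_vectors k\<^esub> \<phi> v)"
  have \<psi>_closed: "\<psi> v \<in> ?V" if "v \<in> ?V" for v
    using a closed[OF that] by (simp add: \<psi>_def)
  have \<psi>_iso: "(pairing k (\<psi> u) (\<psi> v))\<^sup>2 = (pairing k u v)\<^sup>2" if "u \<in> ?V" "v \<in> ?V" for u v
    using iso[OF that] by (simp add: \<psi>_def pairing_mult_left[OF a])
  have \<psi>_one: "\<psi> ?one = ?one"
    using sign_mult_cancel[OF a V.one_closed] a by (simp add: \<psi>_def a_def)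
  have one_flip: "(pairing k ?one (flip k c))\<^sup>2 = (int k - 1)\<^sup>2" if "c \<le> k" for c
    using that
    by (simp add: pairing_flip pairing_self lift_sign_one power_mult_distrib sign_at_square)
  \<comment> \<open>The unit vectors are exactly the vectors whose squared pairing with the identity
    is that of k - 1, so \<open>\<psi>\<close> sends unit vectors to unit vectors.\<close>
  have "\<exists>d\<le>k. \<psi> (flip k c) = flip k d" if "c \<le> k" for c
    using eq_flip_if_pairing_one[OF \<psi>_closed[OF flip_closed]] one_flip[OF that]
      \<psi>_iso[OF V.one_closed flip_closed] \<psi>_one by metis
  then obtain s where s: "\<And>c. c \<le> k \<Longrightarrow> s c \<le> k" "\<And>c. c \<le> k \<Longrightarrow> \<psi> (flip k c) = flip k (s c)"
    by metis
  define \<sigma> where "\<sigma> = (\<lambda>c. if c \<in> {0..k} then s c else c)"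
  \<comment> \<open>The squared pairing, which \<open>\<psi>\<close> preserves, tells equal unit
    vectors from distinct ones: the bases are k + 1 and k - 3.\<close>
  have "inj_on s {0..k}"
  proof (rule inj_onI)
    fix c d assume cd: "c \<in> {0..k}" "d \<in> {0..k}" "s c = s d"
    then have "\<psi> (flip k c) = \<psi> (flip k d)" using s(2) by simp
    then have sq: "(pairing k (flip k c) (flip k d))\<^sup>2 = (int k + 1)\<^sup>2"
      using \<psi>_iso[OF flip_closed flip_closed, of c d] \<psi>_closed[OF flip_closed, of d]
      by (simp add: pairing_self)
    show "c = d"
    proof (rule ccontr)
      assume "c \<noteq> d"
      then have "(int k + 1)\<^sup>2 = (int k - 3)\<^sup>2"
        using sq pairing_flip_flip[of c k d] cd by simp
      then show False using k(1) by (simp add: power2_eq_iff)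
    qed
  qed
  then have "bij_betw s {0..k} {0..k}"
    using s(1) by (intro bij_betw_imageI endo_inj_surj) auto
  moreover have "bij_betw \<sigma> {0..k} {0..k} \<longleftrightarrow> bij_betw s {0..k} {0..k}"
    by (rule bij_betw_cong) (simp add: \<sigma>_def)
  ultimately have \<sigma>: "\<sigma> permutes {0..k}"
    by (intro bij_imp_permutes) (auto simp: \<sigma>_def)
  have \<sigma>_flip: "\<psi> (flip k c) = flip k (\<sigma> c)" if "c \<le> k" for c
    using s(2)[OF that] that by (simp add: \<sigma>_def)
  note \<sigma>i = permutes_inv[OF \<sigma>]
  define \<chi> where "\<chi> = (\<lambda>v. sign_action k (inv' \<sigma>) (\<psi> v))"
  have "\<chi> v = v" if v: "v \<in> ?V" for v
  proof (rule pairing_isometry_fixing_flips[OF k _ _ _ _ v])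
    show "\<chi> u \<in> ?V" if "u \<in> ?V" for u
      using \<psi>_closed[OF that] by (simp add: \<chi>_def sign_action_closed[OF \<sigma>i])
    show "(pairing k (\<chi> u) (\<chi> w))\<^sup>2 = (pairing k u w)\<^sup>2" if "u \<in> ?V" "w \<in> ?V" for u w
      using \<psi>_closed that \<psi>_iso by (simp add: \<chi>_def pairing_sign_action[OF \<sigma>i])
    show "\<chi> ?one = ?one"
      by (simp add: \<chi>_def \<psi>_one sign_action_one[OF \<sigma>i])
    show "\<chi> (flip k c) = flip k c" if "c \<le> k" for c
      using that permutes_in_image[OF \<sigma>, of c] permutes_inverses[OF \<sigma>]
      by (simp add: \<chi>_def \<sigma>_flip sign_action_flip[OF \<sigma>i])
  qed
  then have "\<psi> v = sign_action k \<sigma> v" if "v \<in> ?V" for v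
    using that sign_action_comp[OF \<sigma> \<sigma>i \<psi>_closed[OF that]] permutes_inv_o(1)[OF \<sigma>]
      sign_action_id[OF \<psi>_closed[OF that]] by (simp add: \<chi>_def)
  then have "\<phi> v = sign_affine k (a, \<sigma>) v" if "v \<in> ?V" for v
    using that sign_mult_cancel[OF a closed[OF that]] by (simp add: \<psi>_def sign_affine_def)
  then show ?thesis using a \<sigma> by blast
qed


section \<open>The quadratic monomials and their Gram kernel\<close>

text \<open>The pair \<open>(0, 0)\<close> stands for the constant monomial, \<open>(0, j)\<close> for the linear one.\<close>

definition monomial_pairs :: "nat \<Rightarrow> (nat \<times> nat) set" where
  "monomial_pairs k = insert (0, 0) {(i, j). i < j \<and> j \<le> k}"

definition monomial :: "nat \<times> nat \<Rightarrow> (nat \<Rightarrow> int) \<Rightarrow> int" where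
  "monomial r v = lift_sign v (fst r) * lift_sign v (snd r)"

text \<open>The entries of the transposed constraint matrix times the matrix itself. Divided by
  \<open>2 ^ k\<close>, it is the kernel of the orthogonal projection to the span of the
  monomials.\<close>

definition gram :: "nat \<Rightarrow> (nat \<Rightarrow> int) \<Rightarrow> (nat \<Rightarrow> int) \<Rightarrow> int" where
  "gram k u v = (\<Sum>r\<in>monomial_pairs k. monomial r u * monomial r v)"

lemma finite_less_pairs: "finite {(i, j). i < j \<and> j \<le> (k::nat)}"
  by (rule finite_subset[of _ "{0..k} \<times> {0..k}"]) auto

lemma finite_monomial_pairs: "finite (monomial_pairs k)"
  by (simp add: monomial_pairs_def finite_less_pairs)

lemma square_sum_pairs:
  fixes g :: "nat \<Rightarrow> 'a::comm_ring_1"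
  shows "(\<Sum>i=0..k. g i)\<^sup>2 = (\<Sum>i=0..k. (g i)\<^sup>2) + 2 * (\<Sum>(i, j) | i < j \<and> j \<le> k. g i * g j)"
proof (induction k)
  case 0
  have "{(i, j). i < j \<and> j \<le> (0::nat)} = {}" by auto
  then show ?case by (simp only: sum.empty) simp
next
  case (Suc k)
  let ?P = "{(i, j). i < j \<and> j \<le> k}" and ?Q = "(\<lambda>i. (i, Suc k)) ` {0..k}"
  have split: "{(i, j). i < j \<and> j \<le> Suc k} = ?P \<union> ?Q" by (auto simp: le_Suc_eq)
  have disj: "?P \<inter> ?Q = {}" by auto
  have "(\<Sum>(i, j)\<in>?Q. g i * g j) = (\<Sum>i=0..k. g i) * g (Suc k)"
    by (subst sum.reindex) (auto simp: inj_on_def sum_distrib_right)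
  then have "(\<Sum>(i, j) | i < j \<and> j \<le> Suc k. g i * g j) =
      (\<Sum>(i, j)\<in>?P. g i * g j) + (\<Sum>i=0..k. g i) * g (Suc k)"
    unfolding split by (subst sum.union_disjoint[OF finite_less_pairs _ disj]) auto
  then show ?case using Suc by (simp add: power2_sum algebra_simps)
qed

text \<open>The square of the pairing expands into k + 1 diagonal terms, all equal to 1, and twice
  the sum over pairs; the kernel is that sum plus 1 for the constant monomial.\<close>

lemma gram_pairing:
  assumes "u \<in> carrier (sign_vectors k)" "v \<in> carrier (sign_vectors k)"
  shows "2 * gram k u v = (pairing k u v)\<^sup>2 + 1 - int k"
proof -
  let ?g = "\<lambda>i. lift_sign u i * lift_sign v i"
  have "(?g i)\<^sup>2 = 1" if "i \<le> k" for i
    using lift_sign_cases[OF assms(1) that] lift_sign_cases[OF assms(2) that] by auto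
  then have "(\<Sum>i=0..k. (?g i)\<^sup>2) = int k + 1" by simp
  then have "(pairing k u v)\<^sup>2 = int k + 1 + 2 * (\<Sum>(i, j) | i < j \<and> j \<le> k. ?g i * ?g j)"
    unfolding pairing_def square_sum_pairs by simp
  moreover have "gram k u v = 1 + (\<Sum>(i, j) | i < j \<and> j \<le> k. ?g i * ?g j)"
    unfolding gram_def monomial_pairs_def monomial_def
    by (subst sum.insert[OF finite_less_pairs])
       (auto simp: lift_sign_0 case_prod_unfold mult_ac intro!: sum.cong)
  ultimately show ?thesis by simp
qed

section \<open>Orthogonality of the monomials and the reproducing property\<close>

lemma monomial_square:
  assumes "r \<in> monomial_pairs k" "v \<in> carrier (sign_vectors k)"
  shows "monomial r v * monomial r v = 1"
proof -
  have "fst r \<le> k" "snd r \<le> k" using assms(1) by (auto simp: monomial_pairs_def)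
  then show ?thesis
    using lift_sign_cases[OF assms(2), of "fst r"] lift_sign_cases[OF assms(2), of "snd r"]
    by (auto simp: monomial_def)
qed

text \<open>A monomial is multiplicative, and the normalising sign of \<open>flip k c\<close> enters
  both of its factors and cancels.\<close>

lemma monomial_mult_flip:
  assumes "r \<in> monomial_pairs k"
  shows "monomial r (flip k c \<otimes>\<^bsub>sign_vectors k\<^esub> v) =
    sign_at c (fst r) * sign_at c (snd r) * monomial r v"
proof -
  have "fst r \<le> k" "snd r \<le> k" using assms by (auto simp: monomial_pairs_def)
  moreover have "sign_at c 0 * sign_at c 0 = 1" by (simp add: sign_at_def)
  ultimately show ?thesis
    by (simp add: monomial_def lift_sign_mult lift_sign_flip)
qed

text \<open>Distinct pairs are separated by some coordinate \<open>c\<close>. Translation by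
  \<open>flip k c\<close> permutes the sign vectors and negates the summand, so the sum equals its
  own negative.\<close>

lemma monomial_orthogonal:
  assumes r: "r \<in> monomial_pairs k" and s: "s \<in> monomial_pairs k"
  shows "(\<Sum>u\<in>carrier (sign_vectors k). monomial r u * monomial s u) = (if r = s then 2 ^ k else 0)"
proof (cases "r = s")
  case True
  then show ?thesis using monomial_square[OF s] card_sign_vectors[of k] by simp
next
  case False
  let ?V = "carrier (sign_vectors k)"
  obtain c where c:
    "sign_at c (fst r) * sign_at c (snd r) * (sign_at c (fst s) * sign_at c (snd s)) = -1"
  \<comment> \<open>The larger second component occurs exactly once among the four components; if
    the second components agree, the first ones differ and \<open>fst r\<close> occurs exactly
    once.\<close>
  proof (cases "snd r" "snd s" rule: linorder_cases)
    case less
    then show ?thesis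
      using that[of "snd s"] r s by (auto simp: monomial_pairs_def sign_at_def)
  next
    case greater
    then show ?thesis
      using that[of "snd r"] r s by (auto simp: monomial_pairs_def sign_at_def)
  next
    case equal
    have "fst r \<noteq> fst s" using equal False by (simp add: prod_eq_iff)
    then have "fst r \<noteq> snd r" using equal r s by (auto simp: monomial_pairs_def)
    then have "sign_at (fst r) (fst r) = -1" "sign_at (fst r) (snd r) = 1"
      "sign_at (fst r) (fst s) = 1" "sign_at (fst r) (snd s) = 1"
      using equal \<open>fst r \<noteq> fst s\<close> by (simp_all add: sign_at_def)
    then show ?thesis using that[of "fst r"] by simp
  qed
  let ?m = "\<lambda>u. flip k c \<otimes>\<^bsub>sign_vectors k\<^esub> u"
  have bij: "bij_betw ?m ?V ?V"
    by (rule bij_betw_byWitness[where f' = ?m])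
       (auto simp: sign_mult_cancel[OF flip_closed] mult_closed_sign_vectors flip_closed)
  have "(\<Sum>u\<in>?V. monomial r u * monomial s u) = (\<Sum>u\<in>?V. monomial r (?m u) * monomial s (?m u))"
    by (rule sum.reindex_bij_betw[OF bij, symmetric])
  also have "\<dots> = (\<Sum>u\<in>?V. (sign_at c (fst r) * sign_at c (snd r) *
      (sign_at c (fst s) * sign_at c (snd s))) * (monomial r u * monomial s u))"
    by (rule sum.cong[OF refl]) (simp add: monomial_mult_flip[OF r] monomial_mult_flip[OF s])
  also have "\<dots> = - (\<Sum>u\<in>?V. monomial r u * monomial s u)"
    unfolding c by (simp add: sum_negf)
  finally show ?thesis using False by simp
qed

lemma sum_monomial:
  assumes "r \<in> monomial_pairs k"
  shows "(\<Sum>u\<in>carrier (sign_vectors k). monomial r u) = (if r = (0, 0) then 2 ^ k else 0)"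
  using monomial_orthogonal[OF assms, of "(0, 0)"]
  by (simp add: monomial_pairs_def monomial_def lift_sign_0)

text \<open>When the kernel is expanded, orthogonality leaves only the summand
  \<open>s = r\<close>.\<close>

lemma gram_reproducing:
  assumes "r \<in> monomial_pairs k"
  shows "(\<Sum>u\<in>carrier (sign_vectors k). gram k u v * monomial r u) = 2 ^ k * monomial r v"
proof -
  let ?V = "carrier (sign_vectors k)" and ?R = "monomial_pairs k"
  have "(\<Sum>u\<in>?V. gram k u v * monomial r u) =
      (\<Sum>u\<in>?V. \<Sum>s\<in>?R. monomial s v * (monomial s u * monomial r u))"
    unfolding gram_def sum_distrib_right by (simp add: mult_ac)
  also have "\<dots> = (\<Sum>s\<in>?R. monomial s v * (\<Sum>u\<in>?V. monomial s u * monomial r u))"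
    unfolding sum_distrib_left by (rule sum.swap)
  also have "\<dots> = (\<Sum>s\<in>?R. if s = r then monomial s v * 2 ^ k else 0)"
    using assms by (intro sum.cong refl) (simp add: monomial_orthogonal)
  finally show ?thesis using assms by (simp add: finite_monomial_pairs mult.commute)
qed

text \<open>Expanding one of the two kernel factors into monomials lets the reproducing property act
  on the other.\<close>

lemma sum_gram_square:
  "(\<Sum>u\<in>carrier (sign_vectors k). (gram k u v)\<^sup>2) = 2 ^ k * gram k v v"
proof -
  let ?V = "carrier (sign_vectors k)" and ?R = "monomial_pairs k"
  have "(\<Sum>u\<in>?V. (gram k u v)\<^sup>2) =
      (\<Sum>u\<in>?V. \<Sum>r\<in>?R. monomial r v * (gram k u v * monomial r u))"
    unfolding power2_eq_square
    by (rule sum.cong[OF refl], subst (2) gram_def) (simp add: sum_distrib_left mult_ac)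
  also have "\<dots> = (\<Sum>r\<in>?R. monomial r v * (\<Sum>u\<in>?V. gram k u v * monomial r u))"
    unfolding sum_distrib_left by (rule sum.swap)
  also have "\<dots> = (\<Sum>r\<in>?R. monomial r v * (2 ^ k * monomial r v))"
    by (rule sum.cong[OF refl]) (simp add: gram_reproducing)
  finally show ?thesis unfolding gram_def by (simp add: sum_distrib_left mult_ac)
qed

lemma gram_self:
  assumes "v \<in> carrier (sign_vectors k)"
  shows "gram k v v = int (card (monomial_pairs k))"
  using monomial_square[OF _ assms] by (simp add: gram_def)

section \<open>Symmetries of the relaxation preserve the Gram kernel\<close>

lemma full_factorial_closed:
  "full_factorial k D \<Longrightarrow> l \<in> {1..2 ^ k} \<Longrightarrow> D l \<in> carrier (sign_vectors k)"
  unfolding full_factorial_def carrier_sign_vectors by (rule bij_betwE[rule_format])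

lemma sum_full_factorial:
  assumes "full_factorial k D"
  shows "(\<Sum>l=1..2 ^ k. F (D l)) = (\<Sum>u\<in>carrier (sign_vectors k). F u)"
  using assms unfolding full_factorial_def carrier_sign_vectors by (rule sum.reindex_bij_betw)

text \<open>Deleting 0 turns \<open>(0, 0)\<close> into the empty row index and
  \<open>(0, j)\<close> into \<open>{j}\<close>, and leaves the remaining pairs as two-element
  sets.\<close>

lemma oa_rows_monomial_pairs:
  "oa_rows k 2 = (\<lambda>r. {fst r, snd r} - {0}) ` monomial_pairs k"
proof (intro equalityI subsetI)
  fix I assume "I \<in> oa_rows k 2"
  then have I: "I \<subseteq> {1..k}" and "card I \<le> 2" by (auto simp: oa_rows_def)
  have fin: "finite I" using I by (rule finite_subset) simp
  consider "card I = 0" | "card I = 1" | "card I = 2" using \<open>card I \<le> 2\<close> by linarith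
  then have "\<exists>r\<in>monomial_pairs k. I = {fst r, snd r} - {0}"
  proof cases
    case 1
    then show ?thesis using fin by (intro bexI[of _ "(0, 0)"]) (auto simp: monomial_pairs_def)
  next
    case 2
    then obtain j where "I = {j}" using card_1_singletonE by blast
    then show ?thesis using I by (intro bexI[of _ "(0, j)"]) (auto simp: monomial_pairs_def)
  next
    case 3
    then obtain a b where ab: "I = {a, b}" "a \<noteq> b" by (auto simp: card_2_iff)
    then have "I = {min a b, max a b}" "min a b < max a b" by (auto simp: min_def max_def)
    then show ?thesis using I
      by (intro bexI[of _ "(min a b, max a b)"]) (auto simp: monomial_pairs_def)
  qed
  then show "I \<in> (\<lambda>r. {fst r, snd r} - {0}) ` monomial_pairs k" by blast
next
  fix I assume "I \<in> (\<lambda>r. {fst r, snd r} - {0}) ` monomial_pairs k"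
  then obtain i j where ij: "(i, j) \<in> monomial_pairs k" "I = {i, j} - {0}" by force
  have "card I \<le> card {i, j}" unfolding ij(2) by (rule card_mono) auto
  also have "\<dots> \<le> 2" by (simp add: card_insert_if)
  finally show "I \<in> oa_rows k 2" using ij by (auto simp: oa_rows_def monomial_pairs_def)
qed

lemma oa_matrix_monomial:
  assumes "r \<in> monomial_pairs k"
  shows "oa_matrix D ({fst r, snd r} - {0}) l = of_int (monomial r (D l))"
proof -
  obtain i j where r: "r = (i, j)" by force
  consider "i = 0" "j = 0" | "i = 0" "0 < j" | "0 < i" "i < j"
    using assms r by (fastforce simp: monomial_pairs_def)
  then show ?thesis
  proof cases
    case 3
    then have "{i, j} - {0} = {i, j}" by auto
    then show ?thesis using 3 by (simp add: oa_matrix_def monomial_def lift_sign_def r)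
  qed (simp_all add: oa_matrix_def monomial_def lift_sign_def r)
qed

lemma oa_rhs_monomial:
  assumes "r \<in> monomial_pairs k"
  shows "oa_rhs N ({fst r, snd r} - {0}) = (if r = (0, 0) then of_nat N else 0)"
  using assms by (auto simp: oa_rhs_def monomial_pairs_def)

lemma oa_lp_feasible_iff:
  "f \<in> oa_lp_feasible N k 2 D \<longleftrightarrow> f \<in> {1..2 ^ k} \<rightarrow>\<^sub>E {q. 0 \<le> q} \<and>
    (\<forall>r\<in>monomial_pairs k. (\<Sum>l=1..2 ^ k. of_int (monomial r (D l)) * f l) =
      (if r = (0, 0) then of_nat N else 0))"
  unfolding oa_lp_feasible_def oa_rows_monomial_pairs
  by (simp add: oa_matrix_monomial oa_rhs_monomial)

text \<open>Substituting \<open>\<pi> l\<close> for the summation index moves the permutation from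
  the vector to the rows of the design.\<close>

lemma permute_vec_feasible_iff:
  assumes \<pi>: "\<pi> permutes {1..2 ^ k}" and f: "f \<in> {1..2 ^ k} \<rightarrow>\<^sub>E {q. 0 \<le> q}"
  shows "permute_vec \<pi> f \<in> oa_lp_feasible N k 2 D \<longleftrightarrow>
    (\<forall>r\<in>monomial_pairs k. (\<Sum>l=1..2 ^ k. of_int (monomial r (D (\<pi> l))) * f l) =
      (if r = (0, 0) then of_nat N else 0))"
proof -
  note \<pi>i = permutes_inv[OF \<pi>]
  have "permute_vec \<pi> f \<in> {1..2 ^ k} \<rightarrow>\<^sub>E {q. 0 \<le> q}"
  proof (rule PiE_I)
    show "permute_vec \<pi> f l \<in> {q. 0 \<le> q}" if "l \<in> {1..2 ^ k}" for l
      using PiE_mem[OF f] permutes_in_image[OF \<pi>i] that unfolding permute_vec_def comp_def by blast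
    show "permute_vec \<pi> f l = undefined" if "l \<notin> {1..2 ^ k}" for l
      using PiE_arb[OF f that] permutes_not_in[OF \<pi>i that] by (simp add: permute_vec_def)
  qed
  moreover have "(\<Sum>l=1..2 ^ k. of_int (monomial r (D l)) * permute_vec \<pi> f l) =
      (\<Sum>l=1..2 ^ k. of_int (monomial r (D (\<pi> l))) * f l)" for r
    using sum.permute[OF \<pi>, of "\<lambda>l. of_int (monomial r (D l)) * permute_vec \<pi> f l"]
    by (simp add: comp_def permute_vec_def permutes_inverses[OF \<pi>])
  ultimately show ?thesis by (simp add: oa_lp_feasible_iff)
qed

text \<open>A feasible point displaced along the orthogonal complement of the span stays feasible
  after permuting. Hence the permuted monomial is orthogonal to that complement, so it lies in the
  span and the kernel reproduces it.\<close>

lemma gram_kernel_symmetry: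
  assumes D: "full_factorial k D" and N: "N > 0"
    and \<pi>: "\<pi> \<in> feasible_symmetries (2 ^ k) (oa_lp_feasible N k 2 D)"
    and l: "l \<in> {1..2 ^ k}" and r: "r \<in> monomial_pairs k"
  shows "(\<Sum>p=1..2 ^ k. gram k (D p) (D l) * monomial r (D (\<pi> p))) = 2 ^ k * monomial r (D (\<pi> l))"
proof -
  let ?n = "2 ^ k :: nat"
  \<comment> \<open>\<open>h\<close> is proportional to the projection of a unit vector to the orthogonal
    complement of the monomials, so small multiples of it may be added to the uniform solution.\<close>
  define h where "h p = (if p = l then 2 ^ k else 0) - gram k (D p) (D l)" for p
  have h_orth: "(\<Sum>p=1..?n. monomial s (D p) * h p) = 0" if "s \<in> monomial_pairs k" for s
  proof -
    have "(\<Sum>p=1..?n. monomial s (D p) * h p) =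
        (\<Sum>p=1..?n. if p = l then 2 ^ k * monomial s (D p) else 0) -
        (\<Sum>p=1..?n. gram k (D p) (D l) * monomial s (D p))"
      unfolding sum_subtractf[symmetric] by (rule sum.cong[OF refl]) (simp add: h_def algebra_simps)
    also have "\<dots> = 0"
      using sum_full_factorial[OF D, of "\<lambda>u. gram k u (D l) * monomial s u"] l
      by (simp add: gram_reproducing[OF that])
    finally show ?thesis .
  qed
  \<comment> \<open>\<open>C\<close> bounds every entry of \<open>h\<close> in absolute value, which
    makes \<open>f\<close> below nonnegative; the added 1 keeps it positive.\<close>
  define C where "C = (\<Sum>p=1..?n. \<bar>h p\<bar>) + 1"
  have "(\<Sum>p=1..?n. \<bar>h p\<bar>) \<ge> 0" by (rule sum_nonneg) simp
  then have C: "C > 0" by (simp add: C_def)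
  have h_le: "\<bar>h p\<bar> \<le> C" if "p \<in> {1..?n}" for p
    using member_le_sum[of p "{1..?n}" "\<lambda>p. \<bar>h p\<bar>"] that by (simp add: C_def)
  define f :: "nat \<Rightarrow> rat" where
    "f = (\<lambda>p\<in>{1..?n}. of_nat N / 2 ^ k * (1 + of_int (h p) / of_int C))"
  have f: "f \<in> {1..?n} \<rightarrow>\<^sub>E {q. 0 \<le> q}"
  proof -
    have "(0::rat) \<le> 1 + of_int (h p) / of_int C" if "p \<in> {1..?n}" for p
    proof -
      have "- C \<le> h p" using h_le[OF that] by linarith
      then have "- (of_int C::rat) \<le> of_int (h p)" by (metis of_int_le_iff of_int_minus)
      then show ?thesis using C by (simp add: field_simps)
    qed
    then show ?thesis unfolding f_def by (auto intro!: mult_nonneg_nonneg)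
  qed
  \<comment> \<open>The reindexing \<open>\<tau>\<close> will be the identity for the feasibility of
    \<open>f\<close> and \<open>\<pi>\<close> for that of its image.\<close>
  have f_sum: "(\<Sum>p=1..?n. of_int (monomial s (D (\<tau> p))) * f p) =
      of_nat N / 2 ^ k * (of_int (\<Sum>p=1..?n. monomial s (D (\<tau> p))) +
        of_int (\<Sum>p=1..?n. monomial s (D (\<tau> p)) * h p) / of_int C)" for s and \<tau> :: "nat \<Rightarrow> nat"
  proof -
    have "(\<Sum>p=1..?n. of_int (monomial s (D (\<tau> p))) * f p) =
        (\<Sum>p=1..?n. of_nat N / 2 ^ k * (of_int (monomial s (D (\<tau> p))) +
          of_int (monomial s (D (\<tau> p)) * h p) / of_int C))"
      by (rule sum.cong[OF refl]) (use C in \<open>simp add: f_def field_simps\<close>)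
    then show ?thesis
      by (simp only: sum_distrib_left[symmetric] sum.distrib sum_divide_distrib[symmetric] of_int_sum)
  qed
  have mono_sum: "(\<Sum>p=1..?n. monomial s (D p)) = (if s = (0, 0) then 2 ^ k else 0)"
    if "s \<in> monomial_pairs k" for s
    using sum_full_factorial[OF D, of "monomial s"] sum_monomial[OF that] by simp
  have feas: "f \<in> oa_lp_feasible N k 2 D"
    unfolding oa_lp_feasible_iff
  proof (intro conjI ballI f)
    fix s assume s: "s \<in> monomial_pairs k"
    show "(\<Sum>p=1..?n. of_int (monomial s (D p)) * f p) = (if s = (0, 0) then of_nat N else 0)"
      unfolding f_sum[of s "\<lambda>p. p"] mono_sum[OF s] h_orth[OF s] by simp
  qed
  have perm: "\<pi> permutes {1..?n}"
    using \<pi> by (simp add: feasible_symmetries_def sym_group_carrier)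
  have "permute_vec \<pi> f \<in> oa_lp_feasible N k 2 D"
    using \<pi> feas by (simp add: feasible_symmetries_def)
  then have f_perm: "(\<Sum>p=1..?n. of_int (monomial r (D (\<pi> p))) * f p) =
      (if r = (0, 0) then of_nat N else 0)"
    using permute_vec_feasible_iff[OF perm f] r by blast
  have mono_perm: "(\<Sum>p=1..?n. monomial r (D (\<pi> p))) = (if r = (0, 0) then 2 ^ k else 0)"
    using sum.permute[OF perm, of "\<lambda>p. monomial r (D p)"] mono_sum[OF r] by (simp add: comp_def)
  define B where "B = (\<Sum>p=1..?n. monomial r (D (\<pi> p)) * h p)"
  have "of_nat N / 2 ^ k * (of_int (if r = (0, 0) then 2 ^ k else 0) + of_int B / of_int C) =
      (if r = (0, 0) then of_nat N else (0::rat))"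
    using f_perm unfolding f_sum mono_perm B_def .
  \<comment> \<open>The uniform part alone already yields the right-hand side, so the contribution
    of \<open>h\<close> vanishes; \<open>N > 0\<close> lets the common factor be cancelled.\<close>
  then have "B = 0" using C N by (auto simp: distrib_left split: if_splits)
  then have "(\<Sum>p=1..?n. monomial r (D (\<pi> p)) * h p) = 0"
    by (simp only: B_def)
  moreover have "(\<Sum>p=1..?n. monomial r (D (\<pi> p)) * h p) =
        (\<Sum>p=1..?n. if p = l then 2 ^ k * monomial r (D (\<pi> p)) else 0) -
        (\<Sum>p=1..?n. gram k (D p) (D l) * monomial r (D (\<pi> p)))"
    unfolding sum_subtractf[symmetric] by (rule sum.cong[OF refl]) (simp add: h_def algebra_simps)
  ultimately show ?thesis using l by simp
qed

text \<open>The kernel row at \<open>l\<close> and the pulled-back kernel row at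
  \<open>\<pi> l\<close> have the same sum of squares \<open>c\<close>, and their inner product is
  \<open>c\<close> as well. Their difference therefore has sum of squares zero.\<close>

lemma gram_preserved:
  assumes D: "full_factorial k D" and N: "N > 0"
    and \<pi>: "\<pi> \<in> feasible_symmetries (2 ^ k) (oa_lp_feasible N k 2 D)"
    and l: "l \<in> {1..2 ^ k}" and m: "m \<in> {1..2 ^ k}"
  shows "gram k (D (\<pi> m)) (D (\<pi> l)) = gram k (D m) (D l)"
proof -
  let ?n = "2 ^ k :: nat" and ?R = "monomial_pairs k"
  let ?g = "\<lambda>p. gram k (D p) (D l)" and ?h = "\<lambda>p. gram k (D (\<pi> p)) (D (\<pi> l))"
  have perm: "\<pi> permutes {1..?n}"
    using \<pi> by (simp add: feasible_symmetries_def sym_group_carrier)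
  have \<pi>l: "\<pi> l \<in> {1..?n}" using permutes_in_image[OF perm] l by blast
  define c where "c = 2 ^ k * int (card ?R)"
  have self: "2 ^ k * gram k (D p) (D p) = c" if "p \<in> {1..?n}" for p
    using gram_self[OF full_factorial_closed[OF D that]] by (simp add: c_def)
  have gg: "(\<Sum>p=1..?n. (gram k (D p) (D q))\<^sup>2) = c" if "q \<in> {1..?n}" for q
    using sum_full_factorial[OF D, of "\<lambda>u. (gram k u (D q))\<^sup>2"] self[OF that]
    by (simp add: sum_gram_square)
  have hh: "(\<Sum>p=1..?n. (?h p)\<^sup>2) = c"
    using sum.permute[OF perm, of "\<lambda>p. (gram k (D p) (D (\<pi> l)))\<^sup>2"] gg[OF \<pi>l] by (simp add: comp_def)
  \<comment> \<open>Expanding \<open>?h\<close> into monomials leaves permuted monomials summed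
    against the kernel row \<open>?g\<close>, which reproduces them.\<close>
  have "(\<Sum>p=1..?n. ?g p * ?h p) =
      (\<Sum>p=1..?n. \<Sum>r\<in>?R. monomial r (D (\<pi> l)) * (?g p * monomial r (D (\<pi> p))))"
    by (rule sum.cong[OF refl], subst (2) gram_def) (simp add: sum_distrib_left mult_ac)
  also have "\<dots> = (\<Sum>r\<in>?R. monomial r (D (\<pi> l)) * (\<Sum>p=1..?n. ?g p * monomial r (D (\<pi> p))))"
    unfolding sum_distrib_left by (rule sum.swap)
  also have "\<dots> = (\<Sum>r\<in>?R. monomial r (D (\<pi> l)) * (2 ^ k * monomial r (D (\<pi> l))))"
    by (rule sum.cong[OF refl], subst gram_kernel_symmetry[OF D N \<pi> l]) simp_all
  also have "\<dots> = 2 ^ k * gram k (D (\<pi> l)) (D (\<pi> l))"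
    unfolding gram_def by (simp add: sum_distrib_left mult_ac)
  finally have gh: "(\<Sum>p=1..?n. ?g p * ?h p) = c" using self[OF \<pi>l] by simp
  have "(\<Sum>p=1..?n. (?h p - ?g p)\<^sup>2) =
      (\<Sum>p=1..?n. (?h p)\<^sup>2) + (\<Sum>p=1..?n. (?g p)\<^sup>2) - 2 * (\<Sum>p=1..?n. ?g p * ?h p)"
    unfolding sum_distrib_left sum.distrib[symmetric] sum_subtractf[symmetric]
    by (rule sum.cong[OF refl]) (simp add: power2_diff)
  then have "(\<Sum>p=1..?n. (?h p - ?g p)\<^sup>2) = 0" using hh gg[OF l] gh by simp
  then have "(?h m - ?g m)\<^sup>2 = 0"
    using sum_nonneg_eq_0_iff[of "{1..?n}" "\<lambda>p. (?h p - ?g p)\<^sup>2"] m by simp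
  then show ?thesis by simp
qed

text \<open>A feasible vector has inner product \<open>N\<close> with every kernel row. As the
  kernel is preserved, each permuted monomial is a combination of kernel rows, which determines its
  inner product with the vector.\<close>

lemma feasible_symmetry_if_gram_preserved:
  assumes D: "full_factorial k D" and perm: "\<pi> permutes {1..2 ^ k}"
    and gram: "\<And>l m. l \<in> {1..2 ^ k} \<Longrightarrow> m \<in> {1..2 ^ k} \<Longrightarrow>
      gram k (D (\<pi> m)) (D (\<pi> l)) = gram k (D m) (D l)"
  shows "\<pi> \<in> feasible_symmetries (2 ^ k) (oa_lp_feasible N k 2 D)"
proof -
  let ?n = "2 ^ k :: nat" and ?R = "monomial_pairs k"
  have "permute_vec \<pi> f \<in> oa_lp_feasible N k 2 D" if feas: "f \<in> oa_lp_feasible N k 2 D" for f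
  proof -
    have f: "f \<in> {1..?n} \<rightarrow>\<^sub>E {q. 0 \<le> q}"
      using feas unfolding oa_lp_feasible_iff by blast
    have f_sum: "(\<Sum>l=1..?n. of_int (monomial r (D l)) * f l) = (if r = (0, 0) then of_nat N else 0)"
      if "r \<in> ?R" for r
      using feas that unfolding oa_lp_feasible_iff by blast
    have f_gram: "(\<Sum>l=1..?n. of_int (gram k (D m) (D l)) * f l) = of_nat N" for m
    proof -
      have "(\<Sum>l=1..?n. of_int (gram k (D m) (D l)) * f l) =
          (\<Sum>l=1..?n. \<Sum>r\<in>?R. of_int (monomial r (D m)) * (of_int (monomial r (D l)) * f l))"
        unfolding gram_def of_int_sum sum_distrib_right by (simp add: mult_ac)
      also have "\<dots> = (\<Sum>r\<in>?R. of_int (monomial r (D m)) *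
          (\<Sum>l=1..?n. of_int (monomial r (D l)) * f l))"
        unfolding sum_distrib_left by (rule sum.swap)
      also have "\<dots> = (\<Sum>r\<in>?R. if r = (0, 0) then of_nat N else 0)"
      proof (rule sum.cong[OF refl])
        fix r assume "r \<in> ?R"
        then show "of_int (monomial r (D m)) * (\<Sum>l=1..?n. of_int (monomial r (D l)) * f l) =
            (if r = (0, 0) then of_nat N else 0)"
          unfolding f_sum[OF \<open>r \<in> ?R\<close>] by (simp add: monomial_def lift_sign_0)
      qed
      finally show ?thesis by (simp add: finite_monomial_pairs monomial_pairs_def finite_less_pairs)
    qed
    have "(\<Sum>l=1..?n. of_int (monomial r (D (\<pi> l))) * f l) = (if r = (0, 0) then of_nat N else 0)"
      if r: "r \<in> ?R" for r
    proof -
      \<comment> \<open>The reproducing property at \<open>\<pi> l\<close>, after reindexing the sum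
        along \<open>\<pi>\<close> and pulling back both arguments of the kernel.\<close>
      have repr: "2 ^ k * monomial r (D (\<pi> l)) =
          (\<Sum>m=1..?n. gram k (D m) (D l) * monomial r (D (\<pi> m)))" if l: "l \<in> {1..?n}" for l
      proof -
        have "2 ^ k * monomial r (D (\<pi> l)) =
            (\<Sum>m=1..?n. gram k (D m) (D (\<pi> l)) * monomial r (D m))"
          using sum_full_factorial[OF D, of "\<lambda>u. gram k u (D (\<pi> l)) * monomial r u"]
          by (simp add: gram_reproducing[OF r])
        also have "\<dots> = (\<Sum>m=1..?n. gram k (D (\<pi> m)) (D (\<pi> l)) * monomial r (D (\<pi> m)))"
          using sum.permute[OF perm, of "\<lambda>m. gram k (D m) (D (\<pi> l)) * monomial r (D m)"]
          by (simp add: comp_def)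
        finally show ?thesis using gram[OF l] by simp
      qed
      have "2 ^ k * (\<Sum>l=1..?n. of_int (monomial r (D (\<pi> l))) * f l) =
          (\<Sum>l=1..?n. of_int (2 ^ k * monomial r (D (\<pi> l))) * f l)"
        by (simp add: sum_distrib_left mult.assoc)
      also have "\<dots> = (\<Sum>l=1..?n. \<Sum>m=1..?n. of_int (monomial r (D (\<pi> m))) *
          (of_int (gram k (D m) (D l)) * f l))"
      proof (rule sum.cong[OF refl])
        fix l assume l: "l \<in> {1..?n}"
        show "of_int (2 ^ k * monomial r (D (\<pi> l))) * f l = (\<Sum>m=1..?n.
            of_int (monomial r (D (\<pi> m))) * (of_int (gram k (D m) (D l)) * f l))"
          unfolding repr[OF l] of_int_sum sum_distrib_right by (simp add: mult_ac)
      qed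
      also have "\<dots> = (\<Sum>m=1..?n. of_int (monomial r (D (\<pi> m))) *
          (\<Sum>l=1..?n. of_int (gram k (D m) (D l)) * f l))"
        unfolding sum_distrib_left by (rule sum.swap)
      also have "\<dots> = of_int (\<Sum>m=1..?n. monomial r (D (\<pi> m))) * of_nat N"
        unfolding f_gram of_int_sum sum_distrib_right ..
      also have "(\<Sum>m=1..?n. monomial r (D (\<pi> m))) = (if r = (0, 0) then 2 ^ k else 0)"
        using sum.permute[OF perm, of "\<lambda>m. monomial r (D m)"] sum_full_factorial[OF D, of "monomial r"]
          sum_monomial[OF r] by (simp add: comp_def)
      finally show ?thesis by (simp split: if_splits)
    qed
    then show ?thesis using permute_vec_feasible_iff[OF perm f] by blast
  qed
  then show ?thesis using perm by (simp add: feasible_symmetries_def sym_group_carrier)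
qed

text \<open>The affine relation \<open>gram_pairing\<close> turns invariance of the kernel into
  invariance of the squared pairing; from here on the linear program enters only through this
  description.\<close>

lemma feasible_symmetries_oa:
  assumes D: "full_factorial k D" and N: "N > 0"
  shows "feasible_symmetries (2 ^ k) (oa_lp_feasible N k 2 D) =
    {\<pi>. \<pi> permutes {1..2 ^ k} \<and> (\<forall>l\<in>{1..2 ^ k}. \<forall>m\<in>{1..2 ^ k}.
      (pairing k (D (\<pi> l)) (D (\<pi> m)))\<^sup>2 = (pairing k (D l) (D m))\<^sup>2)}"
proof -
  have eq: "gram k (D (\<pi> l)) (D (\<pi> m)) = gram k (D l) (D m) \<longleftrightarrow>
      (pairing k (D (\<pi> l)) (D (\<pi> m)))\<^sup>2 = (pairing k (D l) (D m))\<^sup>2"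
    if "\<pi> permutes {1..2 ^ k}" "l \<in> {1..2 ^ k}" "m \<in> {1..2 ^ k}" for \<pi> l m
  proof -
    have "\<pi> l \<in> {1..2 ^ k}" "\<pi> m \<in> {1..2 ^ k}" using permutes_in_image[OF that(1)] that by blast+
    note this[THEN full_factorial_closed[OF D]] that(2,3)[THEN full_factorial_closed[OF D]]
    then show ?thesis
      using gram_pairing[of "D l" k "D m"] gram_pairing[of "D (\<pi> l)" k "D (\<pi> m)"] by auto
  qed
  show ?thesis
  proof (intro equalityI subsetI CollectI conjI ballI)
    fix \<pi> assume \<pi>: "\<pi> \<in> feasible_symmetries (2 ^ k) (oa_lp_feasible N k 2 D)"
    then show perm: "\<pi> permutes {1..2 ^ k}"
      by (simp add: feasible_symmetries_def sym_group_carrier)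
    fix l m :: nat assume "l \<in> {1..2 ^ k}" "m \<in> {1..2 ^ k}"
    then show "(pairing k (D (\<pi> l)) (D (\<pi> m)))\<^sup>2 = (pairing k (D l) (D m))\<^sup>2"
      using gram_preserved[OF D N \<pi>] eq[OF perm] by blast
  next
    fix \<pi> assume "\<pi> \<in> {\<pi>. \<pi> permutes {1..2 ^ k} \<and> (\<forall>l\<in>{1..2 ^ k}. \<forall>m\<in>{1..2 ^ k}.
      (pairing k (D (\<pi> l)) (D (\<pi> m)))\<^sup>2 = (pairing k (D l) (D m))\<^sup>2)}"
    then show "\<pi> \<in> feasible_symmetries (2 ^ k) (oa_lp_feasible N k 2 D)"
      using feasible_symmetry_if_gram_preserved[OF D] eq by blast
  qed
qed

section \<open>The isomorphism\<close>

text \<open>The action is by automorphisms, so moving \<open>\<sigma>\<close> past the inner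
  translation produces the first component of the semidirect multiplication.\<close>

lemma sign_affine_mult:
  assumes a: "a \<in> carrier (sign_vectors k)" "a' \<in> carrier (sign_vectors k)"
    and \<sigma>: "\<sigma> permutes {0..k}" "\<sigma>' permutes {0..k}" and v: "v \<in> carrier (sign_vectors k)"
  shows "sign_affine k (a \<otimes>\<^bsub>sign_vectors k\<^esub> sign_action k \<sigma> a', \<sigma> \<circ> \<sigma>') v =
    sign_affine k (a, \<sigma>) (sign_affine k (a', \<sigma>') v)"
proof -
  interpret V: group "sign_vectors k" by (rule group_sign_vectors)
  have "sign_action k \<sigma> (a' \<otimes>\<^bsub>sign_vectors k\<^esub> sign_action k \<sigma>' v) =
      sign_action k \<sigma> a' \<otimes>\<^bsub>sign_vectors k\<^esub> sign_action k \<sigma> (sign_action k \<sigma>' v)"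
    using sign_action_auto[OF \<sigma>(1)] a(2) sign_action_closed[OF \<sigma>(2) v]
    by (simp add: auto_def hom_mult)
  then show ?thesis
    using a sign_action_closed[OF \<sigma>(1) a(2)]
      sign_action_closed[OF \<sigma>(1) sign_action_closed[OF \<sigma>(2) v]]
    by (simp add: sign_affine_def sign_action_comp[OF \<sigma> v] V.m_assoc)
qed

text \<open>The translation is the image of the identity, and the permutation is visible on the unit
  vectors, which are pairwise distinct for \<open>k \<ge> 2\<close>.\<close>

lemma sign_affine_eqD:
  assumes k: "k \<ge> 2" and a: "a \<in> carrier (sign_vectors k)" "b \<in> carrier (sign_vectors k)"
    and \<sigma>: "\<sigma> permutes {0..k}" "\<tau> permutes {0..k}"
    and eq: "\<And>v. v \<in> carrier (sign_vectors k) \<Longrightarrow> sign_affine k (a, \<sigma>) v = sign_affine k (b, \<tau>) v"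
  shows "a = b" "\<sigma> = \<tau>"
proof -
  interpret V: group "sign_vectors k" by (rule group_sign_vectors)
  show ab: "a = b"
    using eq[OF V.one_closed] a
    by (simp add: sign_affine_def sign_action_one[OF \<sigma>(1)] sign_action_one[OF \<sigma>(2)])
  show "\<sigma> = \<tau>"
  proof
    fix c
    show "\<sigma> c = \<tau> c"
    proof (cases "c \<le> k")
      case True
      then have "flip k (\<sigma> c) = flip k (\<tau> c)"
        using eq[OF flip_closed, of c] a ab
        by (simp add: sign_affine_def sign_action_flip \<sigma> flip_closed)
      then show ?thesis
        using flip_inj[OF k] permutes_in_image[OF \<sigma>(1), of c] permutes_in_image[OF \<sigma>(2), of c] True
        by simp
    next
      case False
      then show ?thesis using \<sigma>[THEN permutes_not_in, of c] by simp
    qed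
  qed
qed

lemma sign_affine_bij:
  assumes a: "a \<in> carrier (sign_vectors k)" and \<sigma>: "\<sigma> permutes {0..k}"
  shows "bij_betw (sign_affine k (a, \<sigma>)) (carrier (sign_vectors k)) (carrier (sign_vectors k))"
proof -
  let ?V = "carrier (sign_vectors k)"
  have "inj_on (sign_affine k (a, \<sigma>)) ?V"
  proof (rule inj_onI)
    fix u v assume uv: "u \<in> ?V" "v \<in> ?V" and "sign_affine k (a, \<sigma>) u = sign_affine k (a, \<sigma>) v"
    then have "sign_action k \<sigma> u = sign_action k \<sigma> v"
      using sign_mult_cancel[OF a sign_action_closed[OF \<sigma>]] unfolding sign_affine_def case_prod_conv
      by metis
    then show "u = v"
      using uv sign_action_auto[OF \<sigma>] by (auto simp: auto_def Bij_def bij_betw_def inj_on_def)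
  qed
  then show ?thesis
    using sign_affine_closed[OF a \<sigma>] finite_sign_vectors
    by (intro bij_betw_imageI endo_inj_surj) auto
qed

text \<open>Conjugation by the listing \<open>D\<close>; the identity outside the index range is
  what \<open>permutes\<close> asks for.\<close>

definition index_map :: "nat \<Rightarrow> (nat \<Rightarrow> nat \<Rightarrow> int) \<Rightarrow> ((nat \<Rightarrow> int) \<Rightarrow> nat \<Rightarrow> int) \<Rightarrow> nat \<Rightarrow> nat" where
  "index_map k D \<phi> l =
     (if l \<in> {1..2 ^ k} then inv_into {1..2 ^ k} D (\<phi> (D l)) else l)"

lemma index_map_permutes:
  assumes D: "full_factorial k D"
    and \<phi>: "bij_betw \<phi> (carrier (sign_vectors k)) (carrier (sign_vectors k))"
  shows "index_map k D \<phi> permutes {1..2 ^ k}"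
proof -
  have DV: "bij_betw D {1..2 ^ k} (carrier (sign_vectors k))"
    using D by (simp add: full_factorial_def carrier_sign_vectors)
  have "bij_betw (inv_into {1..2 ^ k} D \<circ> (\<phi> \<circ> D)) {1..2 ^ k} {1..2 ^ k}"
    by (intro bij_betw_trans[OF _ bij_betw_inv_into[OF DV]] bij_betw_trans[OF DV \<phi>])
  moreover have "bij_betw (index_map k D \<phi>) {1..2 ^ k} {1..2 ^ k} \<longleftrightarrow>
      bij_betw (inv_into {1..2 ^ k} D \<circ> (\<phi> \<circ> D)) {1..2 ^ k} {1..2 ^ k}"
    by (rule bij_betw_cong) (simp add: index_map_def)
  ultimately show ?thesis
    by (intro bij_imp_permutes) (auto simp: index_map_def)
qed

lemma full_factorial_index_map:
  assumes D: "full_factorial k D" and l: "l \<in> {1..2 ^ k}"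
    and \<phi>: "\<phi> (D l) \<in> carrier (sign_vectors k)"
  shows "D (index_map k D \<phi> l) = \<phi> (D l)"
  using assms bij_betw_inv_into_right[of D "{1..2 ^ k}"]
  by (simp add: index_map_def full_factorial_def carrier_sign_vectors)

theorem theorem2:
  fixes k N :: nat and D :: "nat \<Rightarrow> nat \<Rightarrow> int"
  assumes "k \<ge> 4"
    and "N > 0" and "4 dvd N"
    and "full_factorial k D"
  shows "oa_G_LP N k 2 D \<cong>
    semidirect_product (sign_vectors k) (symmetric_group {0..k}) (sign_action k)"
proof -
  note D = assms(4)
  let ?V = "carrier (sign_vectors k)" and ?S = "{1..2 ^ k :: nat}"
  let ?G = "oa_G_LP N k 2 D"
  let ?H = "semidirect_product (sign_vectors k) (symmetric_group {0..k}) (sign_action k)"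
  \<comment> \<open>The isomorphism is built from the semidirect product to the symmetry group and
    inverted at the end.\<close>
  let ?J = "\<lambda>x. index_map k D (sign_affine k x)"
  have H: "x \<in> carrier ?H \<longleftrightarrow> fst x \<in> ?V \<and> snd x permutes {0..k}" for x
    by (cases x) (simp add: semidirect_product_def symmetric_group_def)
  have G: "\<pi> \<in> carrier ?G \<longleftrightarrow> \<pi> permutes ?S \<and> (\<forall>l\<in>?S. \<forall>m\<in>?S.
      (pairing k (D (\<pi> l)) (D (\<pi> m)))\<^sup>2 = (pairing k (D l) (D m))\<^sup>2)" for \<pi>
    by (simp add: oa_G_LP_def feasible_symmetries_oa[OF D assms(2)])
  have inj_D: "inj_on D ?S" and DV: "\<And>l. l \<in> ?S \<Longrightarrow> D l \<in> ?V" and D_surj: "D ` ?S = ?V"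
    using D full_factorial_closed[OF D]
    by (auto simp: full_factorial_def carrier_sign_vectors bij_betw_def)
  have closed: "sign_affine k x v \<in> ?V" if "x \<in> carrier ?H" "v \<in> ?V" for x v
    using that H[of x] sign_affine_closed[of "fst x" k "snd x" v] by simp
  have D_J: "D (?J x l) = sign_affine k x (D l)" if "x \<in> carrier ?H" "l \<in> ?S" for x l
    using full_factorial_index_map[OF D that(2)] closed[OF that(1) DV[OF that(2)]] by blast
  have J_perm: "?J x permutes ?S" if "x \<in> carrier ?H" for x
    using that H[of x] index_map_permutes[OF D sign_affine_bij[of "fst x" k "snd x"]] by simp
  \<comment> \<open>The rows of the design are pairwise distinct, so index permutations can be
    compared through the rows that they select.\<close>
  have perm_eqI: "\<pi> = \<tau>"
    if "\<pi> permutes ?S" "\<tau> permutes ?S" "\<And>l. l \<in> ?S \<Longrightarrow> D (\<pi> l) = D (\<tau> l)" for \<pi> \<tau>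
  proof
    fix l
    show "\<pi> l = \<tau> l"
    proof (cases "l \<in> ?S")
      case True
      then have "\<pi> l \<in> ?S" "\<tau> l \<in> ?S" using that(1,2)[THEN permutes_in_image, of l] by blast+
      then show ?thesis using that(3)[OF True] inj_D by (simp add: inj_on_eq_iff)
    next
      case False
      then show ?thesis using that(1,2)[THEN permutes_not_in, of l] by simp
    qed
  qed
  interpret H: group ?H by (rule group_semidirect_sign)
  have "?J \<in> iso ?H ?G"
  proof (rule isoI)
    show "?J \<in> hom ?H ?G"
    proof (rule homI)
      fix x assume x: "x \<in> carrier ?H"
      have "(pairing k (D (?J x l)) (D (?J x m)))\<^sup>2 = (pairing k (D l) (D m))\<^sup>2"
        if "l \<in> ?S" "m \<in> ?S" for l m
        using pairing_sign_affine[of "fst x" k "snd x" "D l" "D m"] x H[of x] DV that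
        by (simp add: D_J)
      then show "?J x \<in> carrier ?G" using J_perm[OF x] G by blast
    next
      fix x y assume xy: "x \<in> carrier ?H" "y \<in> carrier ?H"
      have mult: "x \<otimes>\<^bsub>?H\<^esub> y =
          (fst x \<otimes>\<^bsub>sign_vectors k\<^esub> sign_action k (snd x) (fst y), snd x \<circ> snd y)"
        by (simp add: semidirect_product_def symmetric_group_def case_prod_unfold)
      have "?J (x \<otimes>\<^bsub>?H\<^esub> y) = ?J x \<circ> ?J y"
      proof (rule perm_eqI)
        show "?J (x \<otimes>\<^bsub>?H\<^esub> y) permutes ?S" using J_perm xy by blast
        show "?J x \<circ> ?J y permutes ?S" using J_perm xy permutes_compose by blast
        fix l assume l: "l \<in> ?S"
        have "?J y l \<in> ?S" using permutes_in_image[OF J_perm[OF xy(2)]] l by blast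
        then have "D ((?J x \<circ> ?J y) l) = sign_affine k x (sign_affine k y (D l))"
          using xy l by (simp add: D_J)
        also have "\<dots> = sign_affine k (x \<otimes>\<^bsub>?H\<^esub> y) (D l)"
          using xy DV[OF l] H[of x] H[of y] sign_affine_mult[of "fst x" k "fst y" "snd x" "snd y" "D l"]
          unfolding mult by simp
        also have "\<dots> = D (?J (x \<otimes>\<^bsub>?H\<^esub> y) l)"
          using xy l by (simp only: D_J H.m_closed)
        finally show "D (?J (x \<otimes>\<^bsub>?H\<^esub> y) l) = D ((?J x \<circ> ?J y) l)" by simp
      qed
      then show "?J (x \<otimes>\<^bsub>?H\<^esub> y) = ?J x \<otimes>\<^bsub>?G\<^esub> ?J y"
        by (simp add: oa_G_LP_def sym_group_def)
    qed
    have "inj_on ?J (carrier ?H)"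
    proof (rule inj_onI)
      fix x y assume xy: "x \<in> carrier ?H" "y \<in> carrier ?H" and eq: "?J x = ?J y"
      have "sign_affine k x v = sign_affine k y v" if "v \<in> ?V" for v
      proof -
        obtain l where "l \<in> ?S" "v = D l" using \<open>v \<in> ?V\<close> D_surj by blast
        then show ?thesis using D_J[OF xy(1), of l] D_J[OF xy(2), of l] eq by simp
      qed
      then show "x = y"
        using sign_affine_eqD[of k "fst x" "fst y" "snd x" "snd y"] xy H[of x] H[of y] assms(1)
        by (simp add: prod_eq_iff)
    qed
    moreover have "?J ` carrier ?H = carrier ?G"
    proof (intro equalityI subsetI)
      fix \<pi> assume "\<pi> \<in> ?J ` carrier ?H"
      then show "\<pi> \<in> carrier ?G" using hom_in_carrier[OF \<open>?J \<in> hom ?H ?G\<close>] by blast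
    next
      fix \<pi> assume "\<pi> \<in> carrier ?G"
      then have perm: "\<pi> permutes ?S" and pres: "\<And>l m. l \<in> ?S \<Longrightarrow> m \<in> ?S \<Longrightarrow>
          (pairing k (D (\<pi> l)) (D (\<pi> m)))\<^sup>2 = (pairing k (D l) (D m))\<^sup>2"
        using G by blast+
      \<comment> \<open>This transports \<open>\<pi>\<close> to the sign vectors, where the
        classification of isometries applies; \<open>k \<ge> 4\<close> keeps clear of its exception
        \<open>k = 3\<close>.\<close>
      define \<phi> where "\<phi> v = D (\<pi> (inv_into ?S D v))" for v
      have inv: "inv_into ?S D v \<in> ?S" "D (inv_into ?S D v) = v" if "v \<in> ?V" for v
        using that D_surj inv_into_into[of v D ?S] f_inv_into_f[of v D ?S] by simp_all
      have "\<phi> v \<in> ?V" if "v \<in> ?V" for v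
        unfolding \<phi>_def using DV permutes_in_image[OF perm] inv(1)[OF that] by blast
      moreover have "(pairing k (\<phi> u) (\<phi> v))\<^sup>2 = (pairing k u v)\<^sup>2" if "u \<in> ?V" "v \<in> ?V" for u v
        using pres[OF inv(1)[OF that(1)] inv(1)[OF that(2)]] inv(2) that by (simp add: \<phi>_def)
      ultimately obtain a \<sigma> where a: "a \<in> ?V" "\<sigma> permutes {0..k}"
        and \<phi>: "\<And>v. v \<in> ?V \<Longrightarrow> \<phi> v = sign_affine k (a, \<sigma>) v"
        using pairing_isometry_is_affine[of k \<phi>] assms(1) by auto
      have x: "(a, \<sigma>) \<in> carrier ?H" using a H by simp
      have "\<pi> = ?J (a, \<sigma>)"
      proof (rule perm_eqI[OF perm J_perm[OF x]])
        fix l assume l: "l \<in> ?S"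
        have "\<phi> (D l) = D (\<pi> l)" unfolding \<phi>_def inv_into_f_f[OF inj_D l] ..
        then show "D (\<pi> l) = D (?J (a, \<sigma>) l)" using \<phi>[OF DV[OF l]] D_J[OF x l] by simp
      qed
      then show "\<pi> \<in> ?J ` carrier ?H" using x by blast
    qed
    ultimately show "bij_betw ?J (carrier ?H) (carrier ?G)" by (simp add: bij_betw_def)
  qed
  then have "?H \<cong> ?G" by (rule is_isoI)
  then show ?thesis by (rule H.iso_sym)
qed

end
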